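(* Let $-\infty<p_1<p_2<+\infty$, let $N\in\mathbb{N}\setminus\{0\}$, $\rho_1,\rho_2\geqslant 1$ and $0<\mu_1,\mu_2<1$. Suppose that $\psi\in\mathcal{C}^1([p_1,p_2],\mathbb{R})$ satisfies Assumption (P$_{\rho_1,\rho_2,N}$) and $U:(p_1,p_2)\to\mathbb{C}$ satisfies Assumption (A$_{\mu_1,\mu_2,N}$) (both written out in the context). Fix $q\in(p_1,p_2)$, and let $\varphi_j,s_j,k_j,\Lambda^{(j)}$ be as in the context. For $j=1,2$ and $\omega>0$ define $$A^{(j)}(\omega):=e^{i\omega\psi(p_j)}\,k_j(0)\,\Theta^{(j)}(\rho_j,\mu_j)\,\omega^{-\frac{\mu_j}{\rho_j}},$$ $$R_1^{(j)}(\omega,q):=(-1)^j e^{i\omega\psi(p_j)}\int_0^{s_j}\phi^{(j)}(s,\omega,\rho_j,\mu_j)\,(k_j)'(s)\,ds,$$ $$R_2^{(j)}(\omega,q):=-\,i\,\frac{\mu_j-\rho_j}{\rho_j}\,e^{i\omega\psi(p_j)}\,k_j(s_j)\int_{\Lambda^{(j)}(s_j)}z^{\mu_j-\rho_j-1}e^{(-1)^{j+1}i\omega z^{\rho_j}}\,dz\;\omega^{-1},$$ where $$\Theta^{(j)}(\rho_j,\mu_j):=\frac{(-1)^{j+1}}{\rho_j}\,\Gamma\Big(\frac{\mu_j}{\rho_j}\Big)e^{(-1)^{j+1}i\frac{\pi}{2}\frac{\mu_j}{\rho_j}},\qquad \phi^{(j)}(s,\omega,\rho_j,\mu_j):=-\int_{\Lambda^{(j)}(s)}z^{\mu_j-1}e^{(-1)^{j+1}i\omega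 z^{\rho_j}}\,dz .$$ Then for all $\omega>0$, $$\int_{p_1}^{p_2}U(p)\,e^{i\omega\psi(p)}\,dp=\sum_{j=1,2}\Big(A^{(j)}(\omega)+R_1^{(j)}(\omega,q)+R_2^{(j)}(\omega,q)\Big),$$ and for $j=1,2$, $$\big|R_1^{(j)}(\omega,q)\big|\leqslant\frac{1}{\rho_j}\,\Gamma\Big(\frac{1}{\rho_j}\Big)\int_0^{s_j}s^{\mu_j-1}\big|(k_j)'(s)\big|\,ds\;\omega^{-\frac{1}{\rho_j}},$$ $$\big|R_2^{(j)}(\omega,q)\big|\leqslant\frac{\rho_j-\mu_j}{\rho_j}\,\Gamma\Big(\frac{1}{\rho_j}\Big)\Big|U(q)\,(\varphi_j)'(q)^{-1}\Big|\,\varphi_j(q)^{-\rho_j}\,\omega^{-\left(1+\frac{1}{\rho_j}\right)}.$$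
   Context: Assumption (P$_{\rho_1,\rho_2,N}$): for $\rho_1,\rho_2\geqslant1$ real, $\psi\in\mathcal{C}^1([p_1,p_2],\mathbb{R})$ satisfies $\psi'(p)=(p-p_1)^{\rho_1-1}(p_2-p)^{\rho_2-1}\tilde\psi(p)$ for all $p\in[p_1,p_2]$, where $\tilde\psi\in\mathcal{C}^N([p_1,p_2],\mathbb{R})$ is positive on $[p_1,p_2]$. Assumption (A$_{\mu_1,\mu_2,N}$): for $0<\mu_1,\mu_2\leqslant1$, $U:(p_1,p_2)\to\mathbb{C}$ is given by $U(p)=(p-p_1)^{\mu_1-1}(p_2-p)^{\mu_2-1}\tilde u(p)$, where $\tilde u\in\mathcal{C}^N([p_1,p_2],\mathbb{C})$ and $\tilde u(p_j)\neq0$ if $\mu_j\neq1$ ($j=1,2$). Notation, for fixed $q\in(p_1,p_2)$: - $I_1:=[p_1,q]$, $I_2:=[q,p_2]$; $\varphi_1:I_1\to\mathbb{R}$, $\varphi_1(p):=(\psi(p)-\psi(p_1))^{1/\rho_1}$; $\varphi_2:I_2\to\mathbb{R}$, $\varphi_2(p):=(\psi(p_2)-\psi(p))^{1/\rho_2}$; $s_j:=\varphi_j(q)$. It is known that $\varphi_j$ is a $\mathcal{C}^{N+1}$-diffeomorphism from $I_j$ onto $[0,s_j]$. - $k_j:(0,s_j]\to\mathbb{C}$, $k_j(s):=U(\varphi_j^{-1}(s))\,s^{1-\mu_j}\,(\varphi_j^{-1})'(s)$. It is known that $k_j$ extends to a function in $\mathcal{C}^N([0,s_j])$; $k_j(0)$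 is the value of this extension. - For $s>0$, $\Lambda^{(j)}(s):=\{s+te^{(-1)^{j+1}i\frac{\pi}{2\rho_j}}\mid t\geqslant0\}$, a half-line in $\mathbb{C}$ oriented in the direction of increasing $t$. Complex powers $z^a$ on it are taken with the principal branch. *)

theory Defs
  imports "HOL-Analysis.Analysis"
begin

(* Functions of class C^n on S, with derivatives taken relative to S; for a nondegenerate
   compact interval these are one-sided at the endpoints. *)

primrec class_C :: "nat \<Rightarrow> real set \<Rightarrow> (real \<Rightarrow> 'a::real_normed_vector) \<Rightarrow> bool" where
  "class_C 0 S f \<longleftrightarrow> continuous_on S f"
| "class_C (Suc n) S f \<longleftrightarrow>
     (\<exists>f'. (\<forall>x\<in>S. (f has_vector_derivative f' x) (at x within S)) \<and> class_C n S f')"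

(* Real powers with the convention 0^0 = 1 (whereas 0 powr 0 = 0).  It matters for the
   value of psi' at an endpoint p j when rho j = 1. *)

definition rpow :: "real \<Rightarrow> real \<Rightarrow> real" where
  "rpow x a = (if a = 0 then 1 else x powr a)"

(* Throughout, families (p_j), (rho_j), (mu_j) indexed by j = 1, 2 are functions on nat, of which
   only the values at 1 and 2 matter. *)

definition assumption_P ::
  "(nat \<Rightarrow> real) \<Rightarrow> (nat \<Rightarrow> real) \<Rightarrow> nat \<Rightarrow> (real \<Rightarrow> real) \<Rightarrow> bool" where
  "assumption_P p \<rho> N \<psi> \<longleftrightarrow>
     \<rho> 1 \<ge> 1 \<and> \<rho> 2 \<ge> 1 \<and> class_C 1 {p 1..p 2} \<psi> \<and>
     (\<exists>\<psi>t :: real \<Rightarrow> real. class_C N {p 1..p 2} \<psi>t \<and> (\<forall>x\<in>{p 1..p 2}. \<psi>t x > 0) \<and>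
        (\<forall>x\<in>{p 1..p 2}. (\<psi> has_vector_derivative
            rpow (x - p 1) (\<rho> 1 - 1) * rpow (p 2 - x) (\<rho> 2 - 1) * \<psi>t x)
            (at x within {p 1..p 2})))"

definition assumption_A ::
  "(nat \<Rightarrow> real) \<Rightarrow> (nat \<Rightarrow> real) \<Rightarrow> nat \<Rightarrow> (real \<Rightarrow> complex) \<Rightarrow> bool" where
  "assumption_A p \<mu> N U \<longleftrightarrow>
     0 < \<mu> 1 \<and> \<mu> 1 \<le> 1 \<and> 0 < \<mu> 2 \<and> \<mu> 2 \<le> 1 \<and>
     (\<exists>ut :: real \<Rightarrow> complex. class_C N {p 1..p 2} ut \<and>
        (\<forall>j\<in>{1, 2}. \<mu> j \<noteq> 1 \<longrightarrow> ut (p j) \<noteq> 0) \<and>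
        (\<forall>x\<in>{p 1<..<p 2}.
           U x = of_real ((x - p 1) powr (\<mu> 1 - 1) * (p 2 - x) powr (\<mu> 2 - 1)) * ut x))"

definition I_sub :: "(nat \<Rightarrow> real) \<Rightarrow> real \<Rightarrow> nat \<Rightarrow> real set" where
  "I_sub p q j = (if j = 1 then {p 1..q} else {q..p 2})"

definition phi ::
  "(nat \<Rightarrow> real) \<Rightarrow> (nat \<Rightarrow> real) \<Rightarrow> (real \<Rightarrow> real) \<Rightarrow> nat \<Rightarrow> real \<Rightarrow> real" where
  "phi p \<rho> \<psi> j x =
     (if j = 1 then (\<psi> x - \<psi> (p 1)) powr (1 / \<rho> 1) else (\<psi> (p 2) - \<psi> x) powr (1 / \<rho> 2))"

definition s_end ::
  "(nat \<Rightarrow> real) \<Rightarrow> (nat \<Rightarrow> real) \<Rightarrow> (real \<Rightarrow> real) \<Rightarrow> real \<Rightarrow> nat \<Rightarrow> real" where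
  "s_end p \<rho> \<psi> q j = phi p \<rho> \<psi> j q"

definition phi_inv ::
  "(nat \<Rightarrow> real) \<Rightarrow> (nat \<Rightarrow> real) \<Rightarrow> (real \<Rightarrow> real) \<Rightarrow> real \<Rightarrow> nat \<Rightarrow> real \<Rightarrow> real" where
  "phi_inv p \<rho> \<psi> q j = the_inv_into (I_sub p q j) (phi p \<rho> \<psi> j)"

(* Intended for s in (0, s_j]; the derivative of phi_inv at s_j is one-sided. *)

definition k_pre ::
  "(nat \<Rightarrow> real) \<Rightarrow> (nat \<Rightarrow> real) \<Rightarrow> (nat \<Rightarrow> real) \<Rightarrow> (real \<Rightarrow> real) \<Rightarrow> (real \<Rightarrow> complex) \<Rightarrow>
   real \<Rightarrow> nat \<Rightarrow> real \<Rightarrow> complex" where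
  "k_pre p \<rho> \<mu> \<psi> U q j s =
     U (phi_inv p \<rho> \<psi> q j s) * of_real (s powr (1 - \<mu> j)) *
     of_real (vector_derivative (phi_inv p \<rho> \<psi> q j) (at s within {0..s_end p \<rho> \<psi> q j}))"

(* The continuous extension of k_pre to [0, s_j]. *)

definition k_fun ::
  "(nat \<Rightarrow> real) \<Rightarrow> (nat \<Rightarrow> real) \<Rightarrow> (nat \<Rightarrow> real) \<Rightarrow> (real \<Rightarrow> real) \<Rightarrow> (real \<Rightarrow> complex) \<Rightarrow>
   real \<Rightarrow> nat \<Rightarrow> real \<Rightarrow> complex" where
  "k_fun p \<rho> \<mu> \<psi> U q j s =
     (if s = 0 then Lim (at_right 0) (k_pre p \<rho> \<mu> \<psi> U q j) else k_pre p \<rho> \<mu> \<psi> U q j s)"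

definition k_deriv ::
  "(nat \<Rightarrow> real) \<Rightarrow> (nat \<Rightarrow> real) \<Rightarrow> (nat \<Rightarrow> real) \<Rightarrow> (real \<Rightarrow> real) \<Rightarrow> (real \<Rightarrow> complex) \<Rightarrow>
   real \<Rightarrow> nat \<Rightarrow> real \<Rightarrow> complex" where
  "k_deriv p \<rho> \<mu> \<psi> U q j s =
     vector_derivative (k_fun p \<rho> \<mu> \<psi> U q j) (at s within {0..s_end p \<rho> \<psi> q j})"

definition Lambda_dir :: "(nat \<Rightarrow> real) \<Rightarrow> nat \<Rightarrow> complex" where
  "Lambda_dir \<rho> j = exp ((-1) ^ (j + 1) * \<i> * of_real (pi / (2 * \<rho> j)))"

(* Integral of f along the half-line Lambda_j(s), parametrised by
   t |-> s + t * Lambda_dir rho j for t >= 0. *)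

definition Lambda_integral :: "(nat \<Rightarrow> real) \<Rightarrow> nat \<Rightarrow> real \<Rightarrow> (complex \<Rightarrow> complex) \<Rightarrow> complex" where
  "Lambda_integral \<rho> j s f =
     integral {0..} (\<lambda>t. f (of_real s + of_real t * Lambda_dir \<rho> j) * Lambda_dir \<rho> j)"

definition Theta :: "(nat \<Rightarrow> real) \<Rightarrow> (nat \<Rightarrow> real) \<Rightarrow> nat \<Rightarrow> complex" where
  "Theta \<rho> \<mu> j =
     of_real ((-1) ^ (j + 1) / \<rho> j * Gamma (\<mu> j / \<rho> j)) *
     exp ((-1) ^ (j + 1) * \<i> * of_real (pi / 2 * (\<mu> j / \<rho> j)))"

definition phi_osc :: "(nat \<Rightarrow> real) \<Rightarrow> (nat \<Rightarrow> real) \<Rightarrow> nat \<Rightarrow> real \<Rightarrow> real \<Rightarrow> complex" where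
  "phi_osc \<rho> \<mu> j s \<omega> =
     - Lambda_integral \<rho> j s
         (\<lambda>z. z powr of_real (\<mu> j - 1) *
              exp ((-1) ^ (j + 1) * \<i> * of_real \<omega> * z powr of_real (\<rho> j)))"

definition A_term ::
  "(nat \<Rightarrow> real) \<Rightarrow> (nat \<Rightarrow> real) \<Rightarrow> (nat \<Rightarrow> real) \<Rightarrow> (real \<Rightarrow> real) \<Rightarrow> (real \<Rightarrow> complex) \<Rightarrow>
   real \<Rightarrow> nat \<Rightarrow> real \<Rightarrow> complex" where
  "A_term p \<rho> \<mu> \<psi> U q j \<omega> =
     exp (\<i> * of_real (\<omega> * \<psi> (p j))) * k_fun p \<rho> \<mu> \<psi> U q j 0 * Theta \<rho> \<mu> j *
     of_real (\<omega> powr (- (\<mu> j / \<rho> j)))"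

definition R1_term ::
  "(nat \<Rightarrow> real) \<Rightarrow> (nat \<Rightarrow> real) \<Rightarrow> (nat \<Rightarrow> real) \<Rightarrow> (real \<Rightarrow> real) \<Rightarrow> (real \<Rightarrow> complex) \<Rightarrow>
   real \<Rightarrow> nat \<Rightarrow> real \<Rightarrow> complex" where
  "R1_term p \<rho> \<mu> \<psi> U q j \<omega> =
     (-1) ^ j * exp (\<i> * of_real (\<omega> * \<psi> (p j))) *
     integral {0..s_end p \<rho> \<psi> q j} (\<lambda>s. phi_osc \<rho> \<mu> j s \<omega> * k_deriv p \<rho> \<mu> \<psi> U q j s)"

definition R2_term ::
  "(nat \<Rightarrow> real) \<Rightarrow> (nat \<Rightarrow> real) \<Rightarrow> (nat \<Rightarrow> real) \<Rightarrow> (real \<Rightarrow> real) \<Rightarrow> (real \<Rightarrow> complex) \<Rightarrow>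
   real \<Rightarrow> nat \<Rightarrow> real \<Rightarrow> complex" where
  "R2_term p \<rho> \<mu> \<psi> U q j \<omega> =
     - \<i> * of_real ((\<mu> j - \<rho> j) / \<rho> j) * exp (\<i> * of_real (\<omega> * \<psi> (p j))) *
     k_fun p \<rho> \<mu> \<psi> U q j (s_end p \<rho> \<psi> q j) *
     Lambda_integral \<rho> j (s_end p \<rho> \<psi> q j)
       (\<lambda>z. z powr of_real (\<mu> j - \<rho> j - 1) *
            exp ((-1) ^ (j + 1) * \<i> * of_real \<omega> * z powr of_real (\<rho> j))) *
     of_real (\<omega> powr (-1))"

end

theory Submission
  imports Defs "HOL-Complex_Analysis.Cauchy_Integral_Theorem"
begin

text \<open>
  The variable \<open>s = \<phi>\<^sub>j(x)\<close> turns the integral over \<open>I\<^sub>j\<close> into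
  \<open>\<plusminus> \<integral> k\<^sub>j(s) s\<^bsup>\<mu>-1\<^esup> exp(\<plusminus>i \<omega> s\<^bsup>\<rho>\<^esup>) ds\<close>, up to a unimodular factor. The function \<open>\<phi>\<^sup>j(s,\<omega>)\<close> is
  a primitive of the oscillating factor: the holomorphic integrand has a primitive \<open>P\<close> on the
  right half-plane, and since it decays like \<open>exp(-\<omega> t\<^bsup>\<rho>\<^esup>)\<close> along the rays \<open>\<Lambda>\<^sup>j(s)\<close>, the limit of
  \<open>P\<close> at the end of the ray does not depend on \<open>s\<close>. Integration by parts against \<open>k\<^sub>j\<close> produces
  \<open>A\<^sup>j\<close> from \<open>s = 0\<close> and \<open>R\<^sub>1\<^sup>j\<close> from \<open>k\<^sub>j'\<close>; a second one along the ray splits the contribution of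
  \<open>s = s\<^sub>j\<close> into \<open>R\<^sub>2\<^sup>j\<close> and \<open>\<plusminus> U(q) exp(i \<omega> \<psi>(q)) / (i \<omega> \<psi>'(q))\<close>, and the latter cancels
  between the two sides of \<open>q\<close>.

  Regularity comes from \<open>\<psi>(p\<^sub>1 + y) - \<psi>(p\<^sub>1) = y\<^bsup>\<rho>\<^esup> W(y)\<close> with
  \<open>W(y) = \<integral>\<^sub>0\<^sup>1 t\<^bsup>\<rho>-1\<^esup> w(y t) dt\<close> of class \<open>C\<^sup>1\<close> and positive, so that \<open>\<phi>(y) = y W(y)\<^bsup>1/\<rho>\<^esup>\<close>
  and \<open>\<phi>' = W\<^bsup>1/\<rho>-1\<^esup> w / \<rho>\<close>.
\<close>

section \<open>Oscillatory integrals along rays\<close>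

lemma has_integral_Ici_iff_Ioi:
  fixes f :: "real \<Rightarrow> 'a::banach"
  shows "(f has_integral I) {a..} \<longleftrightarrow> (f has_integral I) {a<..}"
proof (rule has_integral_spike_set_eq)
  show "negligible {x \<in> {a..} - {a<..}. f x \<noteq> 0}"
    by (rule negligible_subset[of "{a}"]) auto
  show "negligible {x \<in> {a<..} - {a..}. f x \<noteq> 0}"
    by (rule negligible_subset[of "{}"]) auto
qed

text \<open>Substitute u = \<omega> t^r in Euler's integral for \<open>Gamma (a / r)\<close>. The
  case a = 1 gives the constant in the remainder bounds, and a = \<mu> the leading term.\<close>

lemma has_integral_powr_exp_powr:
  fixes a r \<omega> :: real
  assumes "a > 0" "r > 0" "\<omega> > 0"
  shows "((\<lambda>t. t powr (a - 1) * exp (- \<omega> * t powr r)) has_integral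
           (1 / r * Gamma (a / r) * \<omega> powr (- (a / r)))) {0..}"
proof -
  define f :: "real \<Rightarrow> real" where "f = (\<lambda>u. u powr (a / r - 1) / exp u)"
  define g where "g t = \<omega> * t powr r" for t :: real
  define g' where "g' t = \<omega> * (r * t powr (r - 1))" for t :: real
  have G: "(f has_integral Gamma (a / r)) {0<..}"
    using Gamma_integral_real[of "a / r"] assms by (simp add: has_integral_Ici_iff_Ioi f_def)
  have "f absolutely_integrable_on {0<..}"
    by (intro nonnegative_absolutely_integrable_1)
       (use G in \<open>auto simp: f_def integrable_on_def\<close>)
  moreover have img: "g ` {0<..} = {0<..}"
  proof (intro equalityI subsetI)
    fix u :: real assume u: "u \<in> {0<..}"
    have "u = g ((u / \<omega>) powr (1 / r))" "(u / \<omega>) powr (1 / r) \<in> {0<..}"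
      using assms u by (auto simp: g_def powr_powr)
    then show "u \<in> g ` {0<..}" by blast
  qed (use assms in \<open>auto simp: g_def\<close>)
  moreover have "(\<lambda>x. \<bar>g' x\<bar> * f (g x)) absolutely_integrable_on {0<..} \<and>
       integral {0<..} (\<lambda>x. \<bar>g' x\<bar> * f (g x)) = Gamma (a / r)
     \<longleftrightarrow> f absolutely_integrable_on (g ` {0<..}) \<and> integral (g ` {0<..}) f = Gamma (a / r)"
  proof (rule has_absolute_integral_change_of_variables_1')
    show "inj_on g {0<..}"
      using assms by (intro inj_onI, simp add: g_def) (metis less_eq_real_def less_imp_neq linorder_neqE_linordered_idom powr_less_mono2)
    show "(g has_field_derivative g' x) (at x within {0<..})" if "x \<in> {0<..}" for x
      unfolding g_def g'_def using that by (auto intro!: derivative_eq_intros)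
  qed auto
  ultimately have "(\<lambda>x. \<bar>g' x\<bar> * f (g x)) absolutely_integrable_on {0<..} \<and>
       integral {0<..} (\<lambda>x. \<bar>g' x\<bar> * f (g x)) = Gamma (a / r)"
    using G by auto
  then have "((\<lambda>x. \<bar>g' x\<bar> * f (g x)) has_integral Gamma (a / r)) {0<..}"
    by (metis integrable_integral set_lebesgue_integral_eq_integral(1))
  then have "((\<lambda>x. (1 / r * \<omega> powr (- (a / r))) * (\<bar>g' x\<bar> * f (g x))) has_integral
      (1 / r * \<omega> powr (- (a / r))) * Gamma (a / r)) {0<..}"
    by (rule has_integral_mult_right)
  moreover have "(1 / r * \<omega> powr (- (a / r))) * (\<bar>g' x\<bar> * f (g x)) =
      x powr (a - 1) * exp (- \<omega> * x powr r)" if "x \<in> {0<..}" for x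
  proof -
    have 1: "(\<omega> * x powr r) powr (a / r - 1) = \<omega> powr (a / r) / \<omega> * x powr (a - r)"
    proof -
      have "r * (a / r - 1) = a - r" using assms by (simp add: field_simps)
      then have "(x powr r) powr (a / r - 1) = x powr (a - r)" by (simp add: powr_powr)
      then show ?thesis using assms that by (simp add: powr_mult powr_diff[of \<omega>])
    qed
    have 2: "x powr (r - 1) * x powr (a - r) = x powr (a - 1)"
      by (simp flip: powr_add)
    have "(1 / r * \<omega> powr (- (a / r))) * (\<bar>g' x\<bar> * f (g x)) =
      (\<omega> powr (- (a / r)) * \<omega> powr (a / r)) * (x powr (r - 1) * x powr (a - r)) / exp (\<omega> * x powr r)"
      using assms that unfolding f_def g_def g'_def 1 by (simp add: abs_mult field_simps)
    also have "\<dots> = x powr (a - 1) * exp (- \<omega> * x powr r)"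
      using assms by (simp add: 2 exp_minus divide_inverse flip: powr_add)
    finally show ?thesis .
  qed
  ultimately have I: "((\<lambda>x. x powr (a - 1) * exp (- \<omega> * x powr r)) has_integral
      (1 / r * \<omega> powr (- (a / r))) * Gamma (a / r)) {0<..}"
    by (subst (asm) has_integral_cong) auto
  then show ?thesis by (simp add: has_integral_Ici_iff_Ioi mult_ac)
qed

text \<open>Dominated convergence for the truncations of e to [0, n]. It reduces integrals along
  infinite rays to finite ones, to which the fundamental theorem of calculus applies.\<close>

lemma dominated_improper_integral:
  fixes e :: "real \<Rightarrow> complex"
  assumes cont: "continuous_on {0..} e" and dom: "\<And>t. t \<ge> 0 \<Longrightarrow> norm (e t) \<le> g t"
    and g: "g integrable_on {0..}"
  shows "e integrable_on {0..}"
    and "(\<lambda>n. integral {0..real n} e) \<longlonglongrightarrow> integral {0..} e"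
proof -
  define f where "f n t = (if t \<in> {0..real n} then e t else 0)" for n t
  have int: "e integrable_on {0..real n}" for n
    by (intro integrable_continuous_interval continuous_on_subset[OF cont]) auto
  have f1: "f n integrable_on {0..}" for n
    unfolding f_def using int[of n]
    by (subst integrable_restrict_Int) (simp add: Int_absorb2 atLeastatMost_subset_iff Int_commute)
  have f2: "integral {0..} (f n) = integral {0..real n} e" for n
    unfolding f_def by (subst integral_restrict_Int) (simp add: Int_absorb2 Int_commute)
  have f3: "norm (f n t) \<le> g t" if "t \<in> {0..}" for n t
    using dom[of t] that order_trans[OF norm_ge_zero dom[of t]] by (auto simp: f_def)
  have f4: "(\<lambda>n. f n t) \<longlonglongrightarrow> e t" if "t \<in> {0..}" for t
  proof (rule tendsto_eventually)
    show "\<forall>\<^sub>F n in sequentially. f n t = e t"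
      using eventually_ge_at_top[of "nat \<lceil>t\<rceil>"]
      by eventually_elim (use that in \<open>auto simp: f_def\<close>; linarith)
  qed
  show "e integrable_on {0..}"
    by (rule dominated_convergence(1)[OF f1 g f3 f4])
  show "(\<lambda>n. integral {0..real n} e) \<longlonglongrightarrow> integral {0..} e"
    using dominated_convergence(2)[OF f1 g f3 f4] by (simp add: f2)
qed

text \<open>
  There is equality for \<open>s = 0\<close>, and the right-hand side increases with \<open>s\<close>: its derivative is
  \<open>r Im (z\<^bsup>r-1\<^esup>)\<close>, and \<open>z\<close> stays in the sector where \<open>(r - 1) arg z\<close> lies in \<open>[0, \<pi>/2]\<close>.
\<close>

lemma sector_Im_powr:
  fixes r s t :: real
  assumes r: "r \<ge> 1" and s: "s \<ge> 0" and t: "t \<ge> 0"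
  defines "b \<equiv> pi / (2 * r)"
  shows "t powr r \<le> Im ((of_real s + of_real t * cis b) powr of_real r)"
proof (cases "t = 0")
  case True
  then show ?thesis using s by (simp add: powr_of_real)
next
  case False
  then have t: "t > 0" using t by simp
  have b: "0 < b" "b \<le> pi / 2" using r by (auto simp: b_def field_simps)
  define z where "z x = of_real x + of_real t * cis b" for x :: real
  have Imz: "Im (z x) > 0" for x
    using b t by (auto simp: z_def intro!: mult_pos_pos sin_gt_zero)
  have slit: "z x \<notin> \<real>\<^sub>\<le>\<^sub>0" for x
    using Imz[of x] by (auto simp: complex_nonpos_Reals_iff)
  have nz: "z x \<noteq> 0" for x using Imz[of x] by auto
  have Rez: "Re (z x) \<ge> 0" if "x \<ge> 0" for x
    using b t that by (auto simp: z_def intro!: add_nonneg_nonneg mult_nonneg_nonneg cos_ge_zero)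
  have Arg: "0 \<le> Arg (z x)" "Arg (z x) \<le> b" if "x \<ge> 0" for x
  proof -
    have bounds: "0 < Arg (z x)" "Arg (z x) \<le> pi / 2"
      using Im_Ln_pos_lt[OF nz, of x] Re_Ln_pos_le[OF nz, of x] Imz[of x] Rez[OF that]
      by (auto simp: Arg_eq_Im_Ln[OF nz])
    show "0 \<le> Arg (z x)" using bounds by simp
    show "Arg (z x) \<le> b"
    \<comment> \<open>Rotating by -b gives Im (z cis(-b)) = -x sin b \<le> 0, whereas an argument of
      z beyond b would make this imaginary part positive.\<close>
    proof (rule ccontr)
      assume "\<not> Arg (z x) \<le> b"
      then have *: "sin (Arg (z x) - b) > 0"
        using bounds b by (intro sin_gt_zero) auto
      have "z x = norm (z x) * cis (Arg (z x))"
        using rcis_cmod_Arg[of "z x"] by (simp add: rcis_def)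
      then have "z x * cis (- b) = norm (z x) * (cis (Arg (z x)) * cis (- b))"
        by (metis mult.assoc)
      then have "Im (z x * cis (- b)) = norm (z x) * sin (Arg (z x) - b)"
        by (simp only: cis_mult) simp
      moreover have "z x * cis (- b) = of_real x * cis (- b) + of_real t"
        by (simp add: z_def algebra_simps cis_mult)
      then have "Im (z x * cis (- b)) = - x * sin b" by simp
      moreover have "x * sin b \<ge> 0"
        using that b by (intro mult_nonneg_nonneg sin_ge_zero) auto
      ultimately have "norm (z x) * sin (Arg (z x) - b) \<le> 0" by simp
      then show False using * nz[of x] by (simp add: mult_le_0_iff)
    qed
  qed
  have deriv: "((\<lambda>x. Im (z x powr of_real r)) has_real_derivative
      Im (of_real r * z x powr (of_real r - 1))) (at x)" for x
  proof -
    have "((\<lambda>w. (w + of_real t * cis b) powr of_real r) has_field_derivative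
        of_real r * z x powr (of_real r - 1) * 1) (at (of_real x))"
      unfolding z_def
      by (rule DERIV_chain2[OF has_field_derivative_powr])
         (use slit[of x] in \<open>auto simp: z_def intro!: derivative_eq_intros\<close>)
    from has_vector_derivative_real_field[OF this]
    have "((\<lambda>x. z x powr of_real r) has_vector_derivative
        of_real r * z x powr (of_real r - 1)) (at x)"
      by (simp add: z_def)
    then show ?thesis
      unfolding has_real_derivative_iff_has_vector_derivative
      by (rule bounded_linear.has_vector_derivative[OF bounded_linear_Im])
  qed
  have nonneg: "Im (of_real r * z x powr (of_real r - 1)) \<ge> 0" if "x \<ge> 0" for x
  proof -
    have eq: "z x powr (of_real r - 1) =
        of_real (norm (z x) powr (r - 1)) * cis ((r - 1) * Arg (z x))"
    proof -
      have "(of_real r - 1) * Ln (z x) = Complex ((r - 1) * ln (norm (z x))) ((r - 1) * Arg (z x))"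
        using nz[of x] by (simp add: complex_eq_iff Arg_eq_Im_Ln)
      then show ?thesis using nz[of x] by (simp add: powr_def exp_eq_polar)
    qed
    have "(r - 1) * Arg (z x) \<le> r * b"
      using Arg[OF that] r b by (intro mult_mono) auto
    also have "r * b = pi / 2" using r by (simp add: b_def)
    finally have "(r - 1) * Arg (z x) \<le> pi" using pi_gt_zero by linarith
    then have "sin ((r - 1) * Arg (z x)) \<ge> 0"
      using Arg[OF that] r by (intro sin_ge_zero) auto
    then show ?thesis using r unfolding eq by (auto intro!: mult_nonneg_nonneg)
  qed
  have "Im (z 0 powr of_real r) \<le> Im (z s powr of_real r)"
    by (rule DERIV_nonneg_imp_nondecreasing[OF s], rule exI, intro conjI, rule deriv, rule nonneg)
  \<comment> \<open>At x = 0 the choice of b turns (t cis b)^r into i t^r exactly, which gives the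
    starting value of the monotonicity argument.\<close>
  moreover have "z 0 powr of_real r = of_real (t powr r) * \<i>"
  proof -
    have "Ln (cis b) = \<i> * b"
      using b Ln_exp[of "\<i> * b"] by (simp add: cis_conv_exp)
    then have "Ln (z 0) = of_real (ln t) + \<i> * b"
      using t by (simp add: z_def Ln_times_of_real Ln_of_real)
    moreover have "of_real r * (of_real (ln t) + \<i> * of_real b) = Complex (r * ln t) (pi / 2)"
      using r by (simp add: complex_eq_iff b_def)
    ultimately have "z 0 powr of_real r = exp (Complex (r * ln t) (pi / 2))"
      using nz[of 0] by (simp add: powr_def)
    then show ?thesis
      using t by (simp add: exp_eq_polar powr_def)
  qed
  ultimately show ?thesis by (simp add: z_def)
qed

section \<open>The rays and the decay of oscillating powers along them\<close>

lemma norm_powr_of_real: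
  fixes z :: complex
  assumes "z \<noteq> 0"
  shows "norm (z powr of_real a) = norm z powr a"
  using assms by (simp add: powr_def)

text \<open>The sign has two roles: it is the sign of i \<omega> z^\<rho> in the exponent, and the
  direction in which one leaves p_j to enter the interval.\<close>

definition side_sign :: "nat \<Rightarrow> real" where
  "side_sign j = (-1) ^ (j + 1)"

lemma side_sign_cases: "side_sign j = 1 \<or> side_sign j = -1"
  by (auto simp: side_sign_def minus_one_power_iff)

locale steepest_ray =
  fixes \<rho> :: "nat \<Rightarrow> real" and j :: nat and \<omega> :: real
  assumes rho: "\<rho> j \<ge> 1" and omega: "\<omega> > 0"
begin

abbreviation sg :: real where "sg \<equiv> side_sign j"

abbreviation d :: complex where "d \<equiv> Lambda_dir \<rho> j"

definition osc :: "complex \<Rightarrow> complex" where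
  "osc z = exp ((-1) ^ (j + 1) * \<i> * of_real \<omega> * z powr of_real (\<rho> j))"

text \<open>Both ray integrands of the theorem belong to this family: a = \<mu> - 1 in
  \<open>phi_osc\<close> and a = \<mu> - \<rho> - 1 in \<open>R2_term\<close>.\<close>

definition pw :: "real \<Rightarrow> complex \<Rightarrow> complex" where
  "pw a z = z powr of_real a * osc z"

text \<open>The integral of exp(-\<omega> t^\<rho>) over t \<ge> 0, and the source of
  \<Gamma>(1/\<rho>) \<omega>^(-1/\<rho>) in the remainder bounds.\<close>

definition decay_const :: real where
  "decay_const = 1 / \<rho> j * Gamma (1 / \<rho> j) * \<omega> powr (- (1 / \<rho> j))"

lemmas sg_cases = side_sign_cases[of j]

lemma sg_complex: "(-1) ^ (j + 1) = complex_of_real sg"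
  by (simp add: side_sign_def)

lemma osc_sg: "osc z = exp (\<i> * of_real (sg * \<omega>) * z powr of_real (\<rho> j))"
  unfolding osc_def sg_complex by (simp add: mult_ac)

lemma dir_cis: "d = cis (sg * (pi / (2 * \<rho> j)))"
  unfolding Lambda_dir_def sg_complex by (simp add: cis_conv_exp mult_ac)

lemma norm_dir [simp]: "norm d = 1"
  by (simp add: dir_cis)

lemma dir_nz [simp]: "d \<noteq> 0"
  by (simp add: dir_cis)

lemma Re_dir: "Re d \<ge> 0"
proof -
  have "pi / (2 * \<rho> j) \<le> pi / 2" "0 \<le> pi / (2 * \<rho> j)" using rho by (auto simp: field_simps)
  then have "cos (pi / (2 * \<rho> j)) \<ge> 0" by (intro cos_ge_zero) auto
  then show ?thesis using sg_cases by (auto simp: dir_cis)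
qed

lemma Re_ray: "t \<ge> 0 \<Longrightarrow> s \<le> Re (of_real s + of_real t * d)"
  using Re_dir by simp

text \<open>Both bounds rest on Re d \<ge> 0: the real part does not decrease along the ray, and the
  cross term in |s + t d|^2 is nonnegative. The bound by s serves for fixed s > 0; the bound by t
  remains useful as s tends to 0.\<close>

lemma norm_ray_ge:
  assumes "s \<ge> 0" "t \<ge> 0"
  shows "s \<le> norm (of_real s + of_real t * d)" "t \<le> norm (of_real s + of_real t * d)"
proof -
  show "s \<le> norm (of_real s + of_real t * d)"
    using Re_ray[OF assms(2), of s] complex_Re_le_cmod order_trans by blast
  have "(Re d)\<^sup>2 + (Im d)\<^sup>2 = 1"
    using norm_dir by (simp add: cmod_power2[symmetric])
  then have "(norm (of_real s + of_real t * d))\<^sup>2 = s\<^sup>2 + 2 * s * t * Re d + t\<^sup>2"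
    unfolding cmod_power2 by simp algebra
  moreover have "s * t * Re d \<ge> 0" using assms Re_dir by simp
  ultimately have "t\<^sup>2 \<le> (norm (of_real s + of_real t * d))\<^sup>2" by simp
  then show "t \<le> norm (of_real s + of_real t * d)" by (rule power2_le_imp_le) simp
qed

text \<open>For sign 1 this is the sector estimate. For sign -1 the ray is the mirror image in the
  real axis, and conjugation flips the imaginary part.\<close>

lemma Im_ray_powr:
  assumes "s \<ge> 0" "t \<ge> 0"
  shows "t powr \<rho> j \<le> sg * Im ((of_real s + of_real t * d) powr of_real (\<rho> j))"
proof -
  define b where "b = pi / (2 * \<rho> j)"
  have *: "t powr \<rho> j \<le> Im ((of_real s + of_real t * cis b) powr of_real (\<rho> j))"
    using sector_Im_powr[OF rho assms] by (simp add: b_def)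
  show ?thesis
  proof (cases "sg = 1")
    case True
    then show ?thesis using * by (simp add: dir_cis b_def)
  next
    case False
    then have sg: "sg = -1" using sg_cases by simp
    then have d: "of_real s + of_real t * d = cnj (of_real s + of_real t * cis b)"
      by (simp add: dir_cis b_def cis_cnj)
    have "0 \<le> cos b"
      using Re_dir sg by (simp add: dir_cis b_def)
    \<comment> \<open>A nonnegative real part keeps the point off the negative real axis, so the
      principal power commutes with conjugation.\<close>
    then have "0 \<le> Re (of_real s + of_real t * cis b)"
      using assms by simp
    then have "(of_real s + of_real t * d) powr of_real (\<rho> j) =
        cnj ((of_real s + of_real t * cis b) powr of_real (\<rho> j))"
      unfolding d by (subst cnj_powr) auto
    then show ?thesis using * sg by simp
  qed
qed

lemma norm_osc_ray:
  assumes "s \<ge> 0" "t \<ge> 0"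
  shows "norm (osc (of_real s + of_real t * d)) \<le> exp (- \<omega> * t powr \<rho> j)"
proof -
  have "\<omega> * t powr \<rho> j \<le> \<omega> * (sg * Im ((of_real s + of_real t * d) powr of_real (\<rho> j)))"
    using Im_ray_powr[OF assms] omega by (intro mult_left_mono) auto
  then show ?thesis unfolding osc_sg by (simp add: mult_ac)
qed

lemma norm_pw_ray:
  assumes "a \<le> 0" "s > 0" "t \<ge> 0"
  shows "norm (pw a (of_real s + of_real t * d)) \<le> s powr a * exp (- \<omega> * t powr \<rho> j)"
proof -
  have s: "s \<le> norm (of_real s + of_real t * d)" using norm_ray_ge assms by simp
  then have "of_real s + of_real t * d \<noteq> 0" using assms by auto
  then have "norm (pw a (of_real s + of_real t * d)) =
      norm (of_real s + of_real t * d) powr a * norm (osc (of_real s + of_real t * d))"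
    by (simp add: pw_def norm_mult norm_powr_of_real)
  also have "\<dots> \<le> s powr a * exp (- \<omega> * t powr \<rho> j)"
    using s assms by (intro mult_mono norm_osc_ray powr_mono2') auto
  finally show ?thesis .
qed

lemma has_integral_decay:
  "((\<lambda>t. exp (- \<omega> * t powr \<rho> j)) has_integral decay_const) {0..}"
proof -
  have "((\<lambda>t. t powr (1 - 1) * exp (- \<omega> * t powr \<rho> j)) has_integral decay_const) {0<..}"
    using has_integral_powr_exp_powr[of 1 "\<rho> j" \<omega>] rho omega
    by (simp add: has_integral_Ici_iff_Ioi decay_const_def)
  then have "((\<lambda>t. exp (- \<omega> * t powr \<rho> j)) has_integral decay_const) {0<..}"
    by (rule has_integral_eq[rotated]) auto
  then show ?thesis by (simp add: has_integral_Ici_iff_Ioi)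
qed

lemma has_field_derivative_osc:
  assumes "Re z > 0"
  shows "(osc has_field_derivative
     of_real (\<rho> j) * z powr (of_real (\<rho> j - 1)) * (\<i> * of_real (sg * \<omega>)) * osc z) (at z)"
proof -
  have "((\<lambda>z. exp (\<i> * of_real (sg * \<omega>) * z powr of_real (\<rho> j))) has_field_derivative
     exp (\<i> * of_real (sg * \<omega>) * z powr of_real (\<rho> j)) *
      (\<i> * of_real (sg * \<omega>) * (of_real (\<rho> j) * z powr (of_real (\<rho> j) - 1)))) (at z)"
    using assms
    by (intro DERIV_chain2[OF DERIV_exp] DERIV_cmult has_field_derivative_powr)
       (auto simp: complex_nonpos_Reals_iff)
  then show ?thesis
    by (simp add: osc_sg[abs_def] mult_ac)
qed

text \<open>The derivative stays in the family, with exponents a - 1 and a + \<rho> - 1. This gives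
  holomorphy in the right half-plane and is the basis of the integration by parts along
  rays.\<close>

lemma has_field_derivative_pw:
  assumes z: "Re z > 0"
  shows "(pw a has_field_derivative
     of_real a * pw (a - 1) z + \<i> * of_real (sg * \<omega> * \<rho> j) * pw (a + \<rho> j - 1) z) (at z)"
proof -
  have "z \<noteq> 0" using z by auto
  have "((\<lambda>z. z powr of_real a * osc z) has_field_derivative
     (of_real a * z powr (of_real a - 1)) * osc z +
     (of_real (\<rho> j) * z powr (of_real (\<rho> j - 1)) * (\<i> * of_real (sg * \<omega>)) * osc z) * z powr of_real a) (at z)"
    using z by (intro DERIV_mult has_field_derivative_powr has_field_derivative_osc)
       (auto simp: complex_nonpos_Reals_iff)
  moreover have "z powr of_real (a + \<rho> j - 1) = z powr of_real (\<rho> j - 1) * z powr of_real a"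
    using \<open>z \<noteq> 0\<close> by (simp add: powr_add[symmetric] algebra_simps)
  ultimately show ?thesis
    by (simp add: pw_def[abs_def] algebra_simps)
qed

lemma pw_of_real:
  "s \<ge> 0 \<Longrightarrow> pw a (of_real s) =
     of_real (s powr a) * exp (\<i> * of_real (sg * \<omega> * s powr \<rho> j))"
  by (simp add: pw_def osc_sg powr_of_real mult.assoc)

lemma continuous_on_pw_ray:
  assumes "s > 0"
  shows "continuous_on {0..} (\<lambda>t. pw a (of_real s + of_real t * d))"
proof -
  have "continuous_on {z. Re z > 0} (pw a)"
    by (intro continuous_at_imp_continuous_on ballI DERIV_isCont[OF has_field_derivative_pw]) auto
  then show ?thesis
  proof (rule continuous_on_compose2)
    show "(\<lambda>t. of_real s + of_real t * d) ` {0..} \<subseteq> {z. Re z > 0}"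
      using assms Re_ray by (fastforce intro: less_le_trans)
  qed (intro continuous_intros)
qed

lemma
  assumes "a \<le> 0" "s > 0"
  shows pw_ray_integrable: "(\<lambda>t. pw a (of_real s + of_real t * d) * d) integrable_on {0..}"
    and pw_ray_limit: "(\<lambda>n. integral {0..real n} (\<lambda>t. pw a (of_real s + of_real t * d) * d))
           \<longlonglongrightarrow> Lambda_integral \<rho> j s (pw a)"
proof -
  have c: "continuous_on {0..} (\<lambda>t. pw a (of_real s + of_real t * d) * d)"
    by (intro continuous_intros continuous_on_pw_ray assms)
  have g: "(\<lambda>t. s powr a * exp (- \<omega> * t powr \<rho> j)) integrable_on {0..}"
    using has_integral_decay by (intro integrable_on_mult_right) (auto simp: integrable_on_def)
  have b: "norm (pw a (of_real s + of_real t * d) * d) \<le> s powr a * exp (- \<omega> * t powr \<rho> j)"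
    if "t \<ge> 0" for t
    using norm_pw_ray[OF assms that] by (simp add: norm_mult)
  show "(\<lambda>t. pw a (of_real s + of_real t * d) * d) integrable_on {0..}"
    by (rule dominated_improper_integral(1)[OF c b g])
  show "(\<lambda>n. integral {0..real n} (\<lambda>t. pw a (of_real s + of_real t * d) * d))
           \<longlonglongrightarrow> Lambda_integral \<rho> j s (pw a)"
    unfolding Lambda_integral_def by (rule dominated_improper_integral(2)[OF c b g])
qed

lemma norm_Lambda_integral_pw:
  assumes "a \<le> 0" "s > 0"
  shows "norm (Lambda_integral \<rho> j s (pw a)) \<le> s powr a * decay_const"
  unfolding Lambda_integral_def
proof (rule order_trans[OF integral_norm_bound_integral[OF pw_ray_integrable[OF assms]]])
  have I: "((\<lambda>t. s powr a * exp (- \<omega> * t powr \<rho> j)) has_integral s powr a * decay_const) {0..}"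
    by (intro has_integral_mult_right has_integral_decay)
  show "(\<lambda>t. s powr a * exp (- \<omega> * t powr \<rho> j)) integrable_on {0..}"
    using I by blast
  show "integral {0..} (\<lambda>t. s powr a * exp (- \<omega> * t powr \<rho> j)) \<le> s powr a * decay_const"
    by (simp only: integral_unique[OF I])
qed (use norm_pw_ray[OF assms] in \<open>simp add: norm_mult\<close>)

lemma decay_tendsto_0: "(\<lambda>n. exp (- \<omega> * real n powr \<rho> j)) \<longlonglongrightarrow> 0"
proof -
  have "filterlim (\<lambda>n. real n powr \<rho> j) at_top sequentially"
  proof (rule filterlim_at_top_mono[OF filterlim_real_sequentially])
    show "\<forall>\<^sub>F n in sequentially. real n \<le> real n powr \<rho> j"
      using eventually_ge_at_top[of 1]
    proof eventually_elim
      case (elim n)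
      then show ?case using powr_mono[of 1 "\<rho> j" "real n"] rho by simp
    qed
  qed
  then have "filterlim (\<lambda>n. \<omega> * real n powr \<rho> j) at_top sequentially"
    using omega by (intro filterlim_tendsto_pos_mult_at_top[OF tendsto_const])
  then have "filterlim (\<lambda>n. - (\<omega> * real n powr \<rho> j)) at_bot sequentially"
    by (simp add: filterlim_uminus_at_bot)
  from filterlim_compose[OF exp_at_bot this] show ?thesis by simp
qed

lemma pw_ray_tendsto_0:
  assumes "a \<le> 0" "s > 0"
  shows "(\<lambda>n. pw a (of_real s + of_real (real n) * d)) \<longlonglongrightarrow> 0"
proof (rule Lim_null_comparison)
  show "\<forall>\<^sub>F n in sequentially. norm (pw a (of_real s + of_real (real n) * d))
      \<le> s powr a * exp (- \<omega> * real n powr \<rho> j)"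
    using norm_pw_ray[OF assms of_nat_0_le_iff] by (intro always_eventually allI)
  show "(\<lambda>n. s powr a * exp (- \<omega> * real n powr \<rho> j)) \<longlonglongrightarrow> 0"
    using tendsto_mult[OF tendsto_const decay_tendsto_0, of "s powr a"] by (simp only: mult_zero_right)
qed

section \<open>Primitives and integration by parts along the rays\<close>

lemma integral_along_ray:
  assumes "s > 0" and F: "\<And>z. Re z > 0 \<Longrightarrow> (F has_field_derivative f z) (at z)"
  shows "((\<lambda>t. f (of_real s + of_real t * d) * d) has_integral
     (F (of_real s + of_real (real n) * d) - F (of_real s))) {0..real n}"
proof -
  have "((\<lambda>t. f (of_real s + of_real t * d) * d) has_integral
     (F (of_real s + of_real (real n) * d) - F (of_real s + of_real 0 * d))) {0..real n}"
  proof (rule fundamental_theorem_of_calculus)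
    fix t assume "t \<in> {0..real n}"
    \<comment> \<open>Since Re d \<ge> 0, the ray never leaves the half-plane on which F is
      differentiable.\<close>
    then have "Re (of_real s + of_real t * d) > 0"
      using Re_ray[of t s] assms(1) by simp
    from F[OF this]
    have "((\<lambda>z. F (of_real s + z * d)) has_field_derivative
       f (of_real s + of_real t * d) * d) (at (of_real t))"
      by (rule DERIV_chain2) (auto intro!: derivative_eq_intros)
    from has_vector_derivative_real_field[OF this]
    show "((\<lambda>t. F (of_real s + of_real t * d)) has_vector_derivative
        f (of_real s + of_real t * d) * d) (at t within {0..real n})"
      by simp
  qed simp
  then show ?thesis by simp
qed

text \<open>Integrate the derivative of \<open>pw a\<close> along the ray up to t = n and let n
  grow; \<open>pw a\<close> vanishes at the far end. With \<rho> \<ge> 1 the hypothesis on a makes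
  a, a - 1 and a + \<rho> - 1 all nonpositive, as the decay estimates require. It is applied with a
  = \<mu> - \<rho>.\<close>

lemma Lambda_integral_pw_by_parts:
  assumes "a + \<rho> j \<le> 1" "s > 0"
  shows "of_real a * Lambda_integral \<rho> j s (pw (a - 1)) +
     \<i> * of_real (sg * \<omega> * \<rho> j) * Lambda_integral \<rho> j s (pw (a + \<rho> j - 1)) = - pw a (of_real s)"
proof (rule LIMSEQ_unique)
  have a: "a \<le> 0" "a - 1 \<le> 0" "a + \<rho> j - 1 \<le> 0" using assms rho by auto
  let ?I = "\<lambda>n. \<lambda>b. integral {0..real n} (\<lambda>t. pw b (of_real s + of_real t * d) * d)"
  have int: "(\<lambda>t. pw b (of_real s + of_real t * d) * d) integrable_on {0..real n}" for b n
    by (intro integrable_continuous_interval continuous_intros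
        continuous_on_subset[OF continuous_on_pw_ray[OF assms(2)]]) auto
  have "of_real a * ?I n (a - 1) + \<i> * of_real (sg * \<omega> * \<rho> j) * ?I n (a + \<rho> j - 1) =
      pw a (of_real s + of_real (real n) * d) - pw a (of_real s)" for n
  proof (rule has_integral_unique)
    show "((\<lambda>t. (of_real a * pw (a - 1) (of_real s + of_real t * d) +
         \<i> * of_real (sg * \<omega> * \<rho> j) * pw (a + \<rho> j - 1) (of_real s + of_real t * d)) * d)
        has_integral pw a (of_real s + of_real (real n) * d) - pw a (of_real s)) {0..real n}"
      by (rule integral_along_ray[OF assms(2) has_field_derivative_pw])
    have "((\<lambda>t. of_real a * (pw (a - 1) (of_real s + of_real t * d) * d) +
         \<i> * of_real (sg * \<omega> * \<rho> j) * (pw (a + \<rho> j - 1) (of_real s + of_real t * d) * d))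
        has_integral of_real a * ?I n (a - 1) + \<i> * of_real (sg * \<omega> * \<rho> j) * ?I n (a + \<rho> j - 1)) {0..real n}"
      by (intro has_integral_add has_integral_mult_right integrable_integral int)
    then show "((\<lambda>t. (of_real a * pw (a - 1) (of_real s + of_real t * d) +
         \<i> * of_real (sg * \<omega> * \<rho> j) * pw (a + \<rho> j - 1) (of_real s + of_real t * d)) * d)
        has_integral of_real a * ?I n (a - 1) + \<i> * of_real (sg * \<omega> * \<rho> j) * ?I n (a + \<rho> j - 1)) {0..real n}"
      by (simp add: algebra_simps)
  qed
  moreover have "(\<lambda>n. of_real a * ?I n (a - 1) + \<i> * of_real (sg * \<omega> * \<rho> j) * ?I n (a + \<rho> j - 1))
     \<longlonglongrightarrow> of_real a * Lambda_integral \<rho> j s (pw (a - 1)) +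
     \<i> * of_real (sg * \<omega> * \<rho> j) * Lambda_integral \<rho> j s (pw (a + \<rho> j - 1))"
    by (intro tendsto_intros pw_ray_limit a assms)
  ultimately show "(\<lambda>n. pw a (of_real s + of_real (real n) * d) - pw a (of_real s))
     \<longlonglongrightarrow> of_real a * Lambda_integral \<rho> j s (pw (a - 1)) +
     \<i> * of_real (sg * \<omega> * \<rho> j) * Lambda_integral \<rho> j s (pw (a + \<rho> j - 1))"
    by simp
  show "(\<lambda>n. pw a (of_real s + of_real (real n) * d) - pw a (of_real s)) \<longlonglongrightarrow> - pw a (of_real s)"
    using tendsto_diff[OF pw_ray_tendsto_0[OF a(1) assms(2)] tendsto_const, of "pw a (of_real s)"] by simp
qed

text \<open>P exists by convexity of the half-plane. The content is that c does not depend on s: P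
  is compared at s + n d and 1 + n d, which are joined by a horizontal segment on which P' is of the
  order of exp(-\<omega> n^\<rho>).\<close>

lemma Lambda_integral_pw_primitive:
  assumes a: "a \<le> 0"
  obtains P c where "\<And>z. Re z > 0 \<Longrightarrow> (P has_field_derivative pw a z) (at z)"
    and "\<And>s. s > 0 \<Longrightarrow> Lambda_integral \<rho> j s (pw a) = c - P (of_real s)"
proof -
  have op: "open {z. Re z > 0}" by (rule open_halfspace_Re_gt)
  have hol: "pw a holomorphic_on {z. Re z > 0}"
    by (auto simp: holomorphic_on_open[OF op] intro!: exI has_field_derivative_pw)
  obtain P where P_within: "\<And>z. z \<in> {z. Re z > 0} \<Longrightarrow> (P has_field_derivative pw a z) (at z within {z. Re z > 0})"
  proof (rule holomorphic_convex_primitive'[OF convex_halfspace_Re_gt op hol])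
    fix g assume "\<And>z. z \<in> {z. Re z > 0} \<Longrightarrow> (g has_field_derivative pw a z) (at z within {z. Re z > 0})"
    then show thesis by (rule that)
  qed
  have P: "(P has_field_derivative pw a z) (at z)" if "Re z > 0" for z
    using P_within[of z] at_within_open[of z, OF _ op] that by simp
  let ?P = "\<lambda>n s. P (of_real s + of_real (real n) * d)"
  have lim: "(\<lambda>n. ?P n s - P (of_real s)) \<longlonglongrightarrow> Lambda_integral \<rho> j s (pw a)" if "s > 0" for s
    using pw_ray_limit[OF a that] integral_unique[OF integral_along_ray[OF that P]] by simp
  have diff: "(\<lambda>n. ?P n s - ?P n 1) \<longlonglongrightarrow> 0" if "s > 0" for s
  proof (rule Lim_null_comparison)
    \<comment> \<open>Every x on the segment between s and 1 satisfies x \<ge> m > 0, hence x^a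
      \<le> m^a for a \<le> 0, uniformly in n.\<close>
    define m where "m = min s 1"
    show "\<forall>\<^sub>F n in sequentially. norm (?P n s - ?P n 1)
        \<le> m powr a * exp (- \<omega> * real n powr \<rho> j) * norm (complex_of_real s - 1)"
    proof (rule always_eventually, rule allI)
      fix n
      let ?S = "(\<lambda>x. of_real x + of_real (real n) * d) ` {m..max s 1}"
      have m: "m > 0" using that by (simp add: m_def)
      have "convex ?S"
      proof -
        have "?S = (\<lambda>z. of_real (real n) * d + z) ` (of_real ` {m..max s 1})"
          unfolding image_image by (simp only: add.commute)
        moreover have "convex (complex_of_real ` {m..max s 1})"
          by (intro convex_linear_image bounded_linear.linear[OF bounded_linear_of_real]) simp
        ultimately show ?thesis by (simp only: convex_translation)
      qed
      moreover have "(P has_field_derivative pw a z) (at z within ?S)"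
        "norm (pw a z) \<le> m powr a * exp (- \<omega> * real n powr \<rho> j)" if z: "z \<in> ?S" for z
      proof -
        obtain x where x: "z = of_real x + of_real (real n) * d" "m \<le> x"
          using z by (elim imageE) simp
        have "Re z > 0" using m x(2) Re_ray[of "real n" x] unfolding x(1) by linarith
        then show "(P has_field_derivative pw a z) (at z within ?S)"
          by (rule has_field_derivative_at_within[OF P])
        have "norm (pw a z) \<le> x powr a * exp (- \<omega> * real n powr \<rho> j)"
          unfolding x(1) using x m a by (intro norm_pw_ray) auto
        also have "\<dots> \<le> m powr a * exp (- \<omega> * real n powr \<rho> j)"
          using x m a by (intro mult_right_mono powr_mono2') auto
        finally show "norm (pw a z) \<le> m powr a * exp (- \<omega> * real n powr \<rho> j)" .
      qed
      moreover have "of_real s + of_real (real n) * d \<in> ?S"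
        by (rule image_eqI[where x = s]) (auto simp: m_def)
      moreover have "of_real 1 + of_real (real n) * d \<in> ?S"
        by (rule image_eqI[where x = 1]) (auto simp: m_def)
      ultimately have "norm (?P n s - ?P n 1) \<le> m powr a * exp (- \<omega> * real n powr \<rho> j) *
          norm (of_real s + of_real (real n) * d - (of_real 1 + of_real (real n) * d))"
        by (rule field_differentiable_bound[where f = P and f' = "pw a" and S = ?S])
      then show "norm (?P n s - ?P n 1) \<le> m powr a * exp (- \<omega> * real n powr \<rho> j) *
          norm (complex_of_real s - 1)" by (simp only: add_diff_cancel_right of_real_1)
    qed
    show "(\<lambda>n. m powr a * exp (- \<omega> * real n powr \<rho> j) * norm (complex_of_real s - 1)) \<longlonglongrightarrow> 0"
      using tendsto_mult[OF tendsto_mult[OF tendsto_const decay_tendsto_0] tendsto_const,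
        of "m powr a" "norm (complex_of_real s - 1)"] by (simp only: mult_zero_left mult_zero_right)
  qed
  show ?thesis
  proof (rule that[OF P])
    fix s :: real assume s: "s > 0"
    \<comment> \<open>Telescoping through the base point 1 identifies c as P(1) plus the ray
      integral started at 1.\<close>
    have "(\<lambda>n. (?P n 1 - P (of_real 1)) + (?P n s - ?P n 1) + (P (of_real 1) - P (of_real s)))
       \<longlonglongrightarrow> Lambda_integral \<rho> j 1 (pw a) + 0 + (P (of_real 1) - P (of_real s))"
      by (rule tendsto_add[OF tendsto_add[OF lim[OF zero_less_one] diff[OF s]] tendsto_const])
    moreover have "(?P n 1 - P (of_real 1)) + (?P n s - ?P n 1) + (P (of_real 1) - P (of_real s)) =
        ?P n s - P (of_real s)" for n
      by (simp only: algebra_simps)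
    ultimately have "Lambda_integral \<rho> j 1 (pw a) + 0 + (P (of_real 1) - P (of_real s)) =
        Lambda_integral \<rho> j s (pw a)"
      by (simp only: LIMSEQ_unique[OF _ lim[OF s]])
    then show "Lambda_integral \<rho> j s (pw a) =
        (Lambda_integral \<rho> j 1 (pw a) + P (of_real 1)) - P (of_real s)"
      by (simp only: algebra_simps add_0)
  qed
qed

lemma Lambda_integral_pw_deriv:
  assumes a: "a \<le> 0" and s: "s > 0"
  shows "((\<lambda>s. Lambda_integral \<rho> j s (pw a)) has_vector_derivative - pw a (of_real s)) (at s)"
proof -
  obtain P c where P: "\<And>z. Re z > 0 \<Longrightarrow> (P has_field_derivative pw a z) (at z)"
    and eq: "\<And>s. s > 0 \<Longrightarrow> Lambda_integral \<rho> j s (pw a) = c - P (of_real s)"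
  proof (rule Lambda_integral_pw_primitive[OF a])
    fix P c assume "\<And>z. Re z > 0 \<Longrightarrow> (P has_field_derivative pw a z) (at z)"
      "\<And>s. s > 0 \<Longrightarrow> Lambda_integral \<rho> j s (pw a) = c - P (of_real s)"
    then show thesis by (rule that)
  qed
  have "((\<lambda>s. P (of_real s)) has_vector_derivative pw a (of_real s)) (at s)"
    by (rule has_vector_derivative_real_field) (use P s in auto)
  then have "((\<lambda>s. c - P (of_real s)) has_vector_derivative - pw a (of_real s)) (at s)"
    by (auto intro!: derivative_eq_intros)
  then show ?thesis
    by (rule has_vector_derivative_transform_within_open[where S="{0<..}"]) (use s eq in auto)
qed

text \<open>On the ray from the origin z^\<rho> is i t^\<rho> up to sign, so the exponential becomes
  real and decreasing; the constant phases of z^(m-1) and of dz combine to the phase occurring in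
  \<open>Theta\<close>.\<close>

lemma pw_ray_0:
  assumes "t > 0"
  shows "pw (m - 1) (of_real 0 + of_real t * d) * d =
     of_real (t powr (m - 1) * exp (- \<omega> * t powr \<rho> j)) * cis (sg * (pi / 2 * (m / \<rho> j)))"
proof -
  define b where "b = pi / (2 * \<rho> j)"
  have b: "0 < b" "b \<le> pi / 2" using rho by (auto simp: b_def field_simps)
  have d: "d = cis (sg * b)" by (simp add: dir_cis b_def)
  \<comment> \<open>The principal logarithm returns the argument sg b because it lies in (-pi, pi];
    all real powers of t d can then be read off.\<close>
  have "- pi < sg * b" "sg * b \<le> pi" using sg_cases b by (auto intro: le_less_trans)
  then have "Ln d = \<i> * of_real (sg * b)"
    using Ln_exp[of "\<i> * of_real (sg * b)"] unfolding d cis_conv_exp by simp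
  then have ln: "Ln (of_real t * d) = of_real (ln t) + \<i> * of_real (sg * b)"
    using assms by (simp add: Ln_times_of_real Ln_of_real)
  have pow: "(of_real t * d) powr of_real a = of_real (t powr a) * cis (sg * b * a)" for a
  proof -
    have "of_real a * Ln (of_real t * d) = Complex (a * ln t) (sg * b * a)"
      unfolding ln by (simp add: complex_eq_iff)
    then show ?thesis using assms by (simp add: powr_def exp_eq_polar)
  qed
  have "sg * b * \<rho> j = sg * (pi / 2)" using rho by (simp add: b_def)
  then have "cis (sg * b * \<rho> j) = cis (sg * (pi / 2))" by (simp only:)
  also have "\<dots> = \<i> * of_real sg"
    using sg_cases by (auto simp: complex_eq_iff)
  finally have "cis (sg * b * \<rho> j) = \<i> * of_real sg" .
  moreover have "sg * sg = 1" using sg_cases by auto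
  ultimately have "osc (of_real t * d) = of_real (exp (- \<omega> * t powr \<rho> j))"
  proof -
    assume c: "cis (sg * b * \<rho> j) = \<i> * of_real sg" and sg: "sg * sg = 1"
    have "\<i> * of_real (sg * \<omega>) * (of_real (t powr \<rho> j) * (\<i> * of_real sg)) =
        of_real (- \<omega> * t powr \<rho> j * (sg * sg))"
      by (simp add: algebra_simps)
    then show ?thesis
      unfolding osc_sg pow c sg by (simp only: exp_of_real mult_1_right)
  qed
  moreover have "cis (sg * b * (m - 1)) * d = cis (sg * (pi / 2 * (m / \<rho> j)))"
  proof -
    have "sg * b * (m - 1) + sg * b = sg * (pi / 2 * (m / \<rho> j))"
      using rho by (simp add: b_def field_simps)
    then show ?thesis unfolding d cis_mult by (simp only:)
  qed
  ultimately show ?thesis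
    unfolding pw_def of_real_0 add_0 pow by (simp add: mult.assoc)
qed

lemma Lambda_integral_pw_0:
  assumes m: "m > 0"
  shows "Lambda_integral \<rho> j 0 (pw (m - 1)) =
     of_real (1 / \<rho> j * Gamma (m / \<rho> j) * \<omega> powr (- (m / \<rho> j))) * cis (sg * (pi / 2 * (m / \<rho> j)))"
proof -
  have "((\<lambda>t. t powr (m - 1) * exp (- \<omega> * t powr \<rho> j)) has_integral
      (1 / \<rho> j * Gamma (m / \<rho> j) * \<omega> powr (- (m / \<rho> j)))) {0<..}"
    using has_integral_powr_exp_powr[OF m, of "\<rho> j" \<omega>] rho omega
    by (simp add: has_integral_Ici_iff_Ioi)
  from has_integral_mult_left[OF has_integral_of_real[OF this]]
  have "((\<lambda>t. of_real (t powr (m - 1) * exp (- \<omega> * t powr \<rho> j)) * cis (sg * (pi / 2 * (m / \<rho> j)))) has_integral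
     of_real (1 / \<rho> j * Gamma (m / \<rho> j) * \<omega> powr (- (m / \<rho> j))) * cis (sg * (pi / 2 * (m / \<rho> j)))) {0<..}" .
  then have I: "((\<lambda>t. pw (m - 1) (of_real 0 + of_real t * d) * d) has_integral
     of_real (1 / \<rho> j * Gamma (m / \<rho> j) * \<omega> powr (- (m / \<rho> j))) * cis (sg * (pi / 2 * (m / \<rho> j)))) {0<..}"
    by (rule has_integral_eq[rotated]) (simp add: pw_ray_0[simplified])
  show "Lambda_integral \<rho> j 0 (pw (m - 1)) =
     of_real (1 / \<rho> j * Gamma (m / \<rho> j) * \<omega> powr (- (m / \<rho> j))) * cis (sg * (pi / 2 * (m / \<rho> j)))"
    unfolding Lambda_integral_def using I has_integral_Ici_iff_Ioi integral_unique by blast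
qed

text \<open>Dominated convergence with majorant t^(m-1) exp(-\<omega> t^\<rho>), integrable because
  m > 0. As m < 1, the bound |z| \<ge> t controls z^(m-1) uniformly in s.\<close>

lemma Lambda_integral_pw_continuous_at_0:
  assumes m: "0 < m" "m < 1"
  shows "((\<lambda>s. Lambda_integral \<rho> j s (pw (m - 1))) \<longlongrightarrow> Lambda_integral \<rho> j 0 (pw (m - 1))) (at_right 0)"
  unfolding tendsto_at_iff_sequentially
proof (intro allI impI)
  fix X :: "nat \<Rightarrow> real" assume X: "\<forall>i. X i \<in> {0<..} - {0}" and "X \<longlonglongrightarrow> 0"
  let ?f = "\<lambda>s t. pw (m - 1) (of_real s + of_real t * d) * d"
  \<comment> \<open>The point t = 0 is removed because \<open>0 powr (m - 1) = 0\<close> makes the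
    majorant vanish there, while the integrand does not for s > 0.\<close>
  have Ioi: "integral {0..} g = integral {0<..} g" for g :: "real \<Rightarrow> complex"
    unfolding integral_def integrable_on_def by (simp add: has_integral_Ici_iff_Ioi)
  have "(\<lambda>k. integral {0<..} (?f (X k))) \<longlonglongrightarrow> integral {0<..} (?f 0)"
  proof (rule dominated_convergence(2))
    show "?f (X k) integrable_on {0<..}" for k
      using pw_ray_integrable[of "m - 1" "X k"] X m
      by (auto simp: integrable_on_def has_integral_Ici_iff_Ioi)
    show "(\<lambda>t. t powr (m - 1) * exp (- \<omega> * t powr \<rho> j)) integrable_on {0<..}"
      using has_integral_powr_exp_powr[OF m(1), of "\<rho> j" \<omega>] rho omega
      by (auto simp: has_integral_Ici_iff_Ioi)
    fix t :: real assume t: "t \<in> {0<..}"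
    show "norm (?f (X k) t) \<le> t powr (m - 1) * exp (- \<omega> * t powr \<rho> j)" for k
    proof -
      have Xk: "X k > 0" using X by auto
      have n: "t \<le> norm (of_real (X k) + of_real t * d)" using norm_ray_ge(2)[of "X k" t] Xk t by simp
      then have "of_real (X k) + of_real t * d \<noteq> 0" using t by auto
      then have "norm (?f (X k) t) =
        norm (of_real (X k) + of_real t * d) powr (m - 1) * norm (osc (of_real (X k) + of_real t * d))"
        by (simp add: pw_def norm_mult norm_powr_of_real flip: of_real_diff)
      also have "\<dots> \<le> t powr (m - 1) * exp (- \<omega> * t powr \<rho> j)"
        using n m Xk t by (intro mult_mono norm_osc_ray powr_mono2') auto
      finally show ?thesis .
    qed
    show "(\<lambda>k. ?f (X k) t) \<longlonglongrightarrow> ?f 0 t"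
    proof -
      \<comment> \<open>The principal power is continuous at t d only off the nonpositive real axis.
        If Re d = 0, then |d| = 1 forces Im d \<noteq> 0.\<close>
      have dt: "of_real t * d \<notin> \<real>\<^sub>\<le>\<^sub>0"
      proof (cases "Re d > 0")
        case True
        then show ?thesis using t by (auto simp: complex_nonpos_Reals_iff mult_le_0_iff)
      next
        case False
        then have "Im d \<noteq> 0" using Re_dir norm_dir by (auto simp: cmod_def)
        then show ?thesis using t by (auto simp: complex_nonpos_Reals_iff)
      qed
      have "(\<lambda>k. of_real (X k) + of_real t * d) \<longlonglongrightarrow> of_real 0 + of_real t * d"
        by (intro tendsto_intros \<open>X \<longlonglongrightarrow> 0\<close>)
      then show ?thesis
        unfolding pw_def osc_def using dt t rho
        by (intro tendsto_intros \<open>X \<longlonglongrightarrow> 0\<close>) auto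
    qed
  qed
  then show "((\<lambda>s. Lambda_integral \<rho> j s (pw (m - 1))) \<circ> X) \<longlonglongrightarrow> Lambda_integral \<rho> j 0 (pw (m - 1))"
    by (simp add: Lambda_integral_def Ioi comp_def)
qed

end

section \<open>Normal form of the phase near an endpoint\<close>

lemma continuous_on_rpow:
  assumes "a \<ge> 0"
  shows "continuous_on {0..} (\<lambda>x. rpow x a)"
  using assms by (cases "a = 0") (auto simp: rpow_def intro!: continuous_on_powr')

text \<open>The factorization is the fundamental theorem for t -> h(y t) on [0, 1]; W is
  differentiated under the integral sign. The last identity is h' = y^(r-1) w divided by y^(r-1),
  but it is proved without dividing, so that it includes y = 0.\<close>

lemma power_phase_factorization:
  fixes h w w' :: "real \<Rightarrow> real"
  assumes r: "r \<ge> 1"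
    and h: "\<And>y. y \<in> {0..L} \<Longrightarrow>
          (h has_vector_derivative rpow y (r - 1) * w y) (at y within {0..L})"
    and h0: "h 0 = 0"
    and w: "\<And>y. y \<in> {0..L} \<Longrightarrow> (w has_vector_derivative w' y) (at y within {0..L})"
    and w': "continuous_on {0..L} w'"
    and pos: "\<And>y. y \<in> {0..L} \<Longrightarrow> w y > 0"
  obtains W W' where "\<And>y. y \<in> {0..L} \<Longrightarrow> (W has_vector_derivative W' y) (at y within {0..L})"
    and "continuous_on {0..L} W'" and "\<And>y. y \<in> {0..L} \<Longrightarrow> W y > 0"
    and "\<And>y. y \<in> {0..L} \<Longrightarrow> h y = y powr r * W y"
    and "\<And>y. y \<in> {0..L} \<Longrightarrow> r * W y + y * W' y = w y"
proof -
  \<comment> \<open>For r = 1 the weight must be 1 at t = 0 as well; \<open>rpow\<close> makes the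
    integrand continuous on [0, 1] in that case too.\<close>
  define W where "W y = integral {0..1} (\<lambda>t. rpow t (r - 1) * w (y * t))" for y
  define W' where "W' y = integral {0..1} (\<lambda>t. rpow t (r - 1) * (t * w' (y * t)))" for y
  have mem: "y * t \<in> {0..L}" if "y \<in> {0..L}" "t \<in> {0..1}" for y t :: real
    using that mult_left_le[of t y] by auto
  have cw: "continuous_on {0..L} w"
    by (rule continuous_on_vector_derivative[OF w])
  have cr: "continuous_on {0..1} (\<lambda>t. rpow t (r - 1))"
    using r by (intro continuous_on_subset[OF continuous_on_rpow]) auto
  have cwt: "continuous_on {0..1} (\<lambda>t. rpow t (r - 1) * w (y * t))" if "y \<in> {0..L}" for y
    using mem[OF that] by (intro continuous_intros cr continuous_on_compose2[OF cw]) auto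
  have cwt': "continuous_on {0..1} (\<lambda>t. rpow t (r - 1) * (t * w' (y * t)))" if "y \<in> {0..L}" for y
    using mem[OF that] by (intro continuous_intros cr continuous_on_compose2[OF w']) auto
  have joint: "continuous_on ({0..L} \<times> cbox 0 1) (\<lambda>(y, t). rpow t (r - 1) * (t * w' (y * t)))"
    unfolding case_prod_unfold
    by (intro continuous_intros continuous_on_compose2[OF w'] continuous_on_compose2[OF cr])
       (auto intro!: mem simp: box_real)
  have W: "(W has_vector_derivative W' y) (at y within {0..L})" if y: "y \<in> {0..L}" for y
  proof -
    have "((\<lambda>y. integral (cbox 0 1) (\<lambda>t. rpow t (r - 1) * w (y * t))) has_vector_derivative
       integral (cbox 0 1) (\<lambda>t. rpow t (r - 1) * (t * w' (y * t)))) (at y within {0..L})"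
    proof (rule leibniz_rule_vector_derivative[OF _ _ joint y])
      fix x t :: real assume x: "x \<in> {0..L}" and t: "t \<in> cbox 0 1"
      have "(w \<circ> (\<lambda>x. x * t) has_vector_derivative t *\<^sub>R w' (x * t)) (at x within {0..L})"
      proof (rule vector_diff_chain_within)
        show "((\<lambda>x. x * t) has_vector_derivative t) (at x within {0..L})"
          by (auto intro!: derivative_eq_intros)
        show "(w has_vector_derivative w' (x * t)) (at (x * t) within (\<lambda>x. x * t) ` {0..L})"
          by (rule has_vector_derivative_within_subset[OF w]) (use mem t x in auto)
      qed
      then show "((\<lambda>x. rpow t (r - 1) * w (x * t)) has_vector_derivative
          rpow t (r - 1) * (t * w' (x * t))) (at x within {0..L})"
        using has_vector_derivative_mult_right[of "\<lambda>x. w (x * t)" "t * w' (x * t)" _ "rpow t (r - 1)"]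
        by (simp add: comp_def)
    next
      show "(\<lambda>t. rpow t (r - 1) * w (x * t)) integrable_on cbox 0 1" if "x \<in> {0..L}" for x
        using integrable_continuous_interval[OF cwt[OF that]] by simp
    qed simp
    then show ?thesis by (simp add: W_def[abs_def] W'_def)
  qed
  have W'_cont: "continuous_on {0..L} W'"
    using integral_continuous_on_param[OF joint] by (simp add: W'_def[abs_def])
  have fac: "h y = y powr r * W y" if y: "y \<in> {0..L}" for y
  proof (cases "y = 0")
    case False
    then have y0: "y > 0" using y by simp
    have "((\<lambda>t. y * (rpow (y * t) (r - 1) * w (y * t))) has_integral (h (y * 1) - h (y * 0))) {0..1}"
    proof (rule fundamental_theorem_of_calculus)
      fix t :: real assume t: "t \<in> {0..1}"
      have "(h \<circ> (\<lambda>t. y * t) has_vector_derivative y *\<^sub>R (rpow (y * t) (r - 1) * w (y * t))) (at t within {0..1})"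
      proof (rule vector_diff_chain_within)
        show "((\<lambda>t. y * t) has_vector_derivative y) (at t within {0..1})"
          by (auto intro!: derivative_eq_intros)
        show "(h has_vector_derivative rpow (y * t) (r - 1) * w (y * t))
            (at (y * t) within (\<lambda>t. y * t) ` {0..1})"
          by (rule has_vector_derivative_within_subset[OF h]) (use mem[OF y] t in auto)
      qed
      then show "((\<lambda>t. h (y * t)) has_vector_derivative y * (rpow (y * t) (r - 1) * w (y * t))) (at t within {0..1})"
        by (simp add: comp_def)
    qed simp
    then have "((\<lambda>t. y * (rpow (y * t) (r - 1) * w (y * t))) has_integral h y) {0..1}"
      by (simp only: h0 mult_1_right mult_zero_right diff_zero)
    then have "h y = integral {0..1} (\<lambda>t. y * (rpow (y * t) (r - 1) * w (y * t)))"
      by (rule integral_unique[symmetric])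
    also have "\<dots> = integral {0..1} (\<lambda>t. y powr r * (rpow t (r - 1) * w (y * t)))"
    proof (rule integral_cong)
      fix t :: real assume t: "t \<in> {0..1}"
      have "y * rpow (y * t) (r - 1) = y powr r * rpow t (r - 1)"
        using y0 t powr_mult_base[of y "r - 1"] by (simp add: rpow_def powr_mult)
      then show "y * (rpow (y * t) (r - 1) * w (y * t)) = y powr r * (rpow t (r - 1) * w (y * t))"
        by (simp only: mult.assoc[symmetric])
    qed
    finally show ?thesis by (simp add: W_def)
  qed (simp add: h0)
  have ident: "r * W y + y * W' y = w y" if y: "y \<in> {0..L}" for y
  proof -
    \<comment> \<open>Integrate the t-derivative of t^r w(y t) over [0, 1]; its boundary values
      leave w(y).\<close>
    have "((\<lambda>t. r * (rpow t (r - 1) * w (y * t)) + y * (rpow t (r - 1) * (t * w' (y * t)))) has_integral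
       1 powr r * w (y * 1) - 0 powr r * w (y * 0)) {0..1}"
    proof (rule fundamental_theorem_of_calculus_interior)
      show "continuous_on {0..1} (\<lambda>t. t powr r * w (y * t))"
        using mem[OF y] r by (intro continuous_intros continuous_on_powr' continuous_on_compose2[OF cw]) auto
      fix t :: real assume t: "t \<in> {0<..<1}"
      have "(w \<circ> (\<lambda>t. y * t) has_vector_derivative y *\<^sub>R w' (y * t)) (at t within {0..1})"
      proof (rule vector_diff_chain_within)
        show "((\<lambda>t. y * t) has_vector_derivative y) (at t within {0..1})"
          by (auto intro!: derivative_eq_intros)
        show "(w has_vector_derivative w' (y * t)) (at (y * t) within (\<lambda>t. y * t) ` {0..1})"
          by (rule has_vector_derivative_within_subset[OF w]) (use mem[OF y] t in auto)
      qed
      then have "((\<lambda>t. w (y * t)) has_real_derivative y * w' (y * t)) (at t)"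
        using t at_within_interior[of t "{0..1}"]
        by (simp add: comp_def has_real_derivative_iff_has_vector_derivative)
      then have "((\<lambda>t. t powr r * w (y * t)) has_real_derivative
         r * t powr (r - 1) * w (y * t) + y * w' (y * t) * t powr r) (at t)"
        using t by (intro DERIV_mult has_real_derivative_powr) auto
      moreover have "r * t powr (r - 1) * w (y * t) + y * w' (y * t) * t powr r =
          r * (rpow t (r - 1) * w (y * t)) + y * (rpow t (r - 1) * (t * w' (y * t)))"
        using t powr_mult_base[of t "r - 1"] by (auto simp: rpow_def algebra_simps)
      ultimately show "((\<lambda>t. t powr r * w (y * t)) has_vector_derivative
        r * (rpow t (r - 1) * w (y * t)) + y * (rpow t (r - 1) * (t * w' (y * t)))) (at t)"
        by (simp add: has_real_derivative_iff_has_vector_derivative)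
    qed simp
    moreover have "((\<lambda>t. r * (rpow t (r - 1) * w (y * t)) + y * (rpow t (r - 1) * (t * w' (y * t)))) has_integral
       r * W y + y * W' y) {0..1}"
      unfolding W_def W'_def
      by (intro has_integral_add has_integral_mult_right integrable_integral
          integrable_continuous_interval cwt cwt' y)
    ultimately have "1 powr r * w (y * 1) - 0 powr r * w (y * 0) = r * W y + y * W' y"
      by (rule has_integral_unique)
    then show ?thesis by simp
  qed
  have W_pos: "W y > 0" if y: "y \<in> {0..L}" for y
  proof -
    \<comment> \<open>The minimum of w on the segment from 0 to y; it yields W(y) \<ge> m /
      r.\<close>
    obtain m where m: "m > 0" "\<And>t. t \<in> {0..1} \<Longrightarrow> m \<le> w (y * t)"
    proof -
      have "continuous_on {0..1} (\<lambda>t. w (y * t))"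
        using mem[OF y] by (intro continuous_intros continuous_on_compose2[OF cw]) auto
      then obtain t0 where "t0 \<in> {0..1}" "\<And>t. t \<in> {0..1} \<Longrightarrow> w (y * t0) \<le> w (y * t)"
        using continuous_attains_inf[of "{0..1::real}" "\<lambda>t. w (y * t)"] by auto
      then show thesis using that[of "w (y * t0)"] pos mem[OF y] by auto
    qed
    have I: "((\<lambda>t. m * t powr (r - 1)) has_integral m * (1 powr (r - 1 + 1) / (r - 1 + 1))) {0..1}"
      using r by (intro has_integral_mult_right has_integral_powr_from_0) auto
    have "m * (1 powr (r - 1 + 1) / (r - 1 + 1)) \<le> W y"
      unfolding W_def
    proof (rule has_integral_le[OF I integrable_integral[OF integrable_continuous_interval[OF cwt[OF y]]]])
      fix t :: real assume t: "t \<in> {0..1}"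
      have "t powr (r - 1) \<le> rpow t (r - 1)" "0 \<le> rpow t (r - 1)"
        using t by (auto simp: rpow_def)
      then have "t powr (r - 1) * m \<le> rpow t (r - 1) * w (y * t)"
        using m(1) m(2)[OF t] by (intro mult_mono) auto
      then show "m * t powr (r - 1) \<le> rpow t (r - 1) * w (y * t)" by (simp add: mult.commute)
    qed
    moreover have "m * (1 powr (r - 1 + 1) / (r - 1 + 1)) > 0" using m r by simp
    ultimately show ?thesis by linarith
  qed
  show ?thesis by (rule that[OF W W'_cont W_pos fac ident])
qed

text \<open>The inverse of a continuous injection on a compact set is continuous, so the difference
  quotients of g are reciprocals of those of f taken along g(x) -> g(y). Staying within S covers the
  one-sided derivatives at the ends of an interval.\<close>

lemma inverse_has_vector_derivative_within:
  fixes f f' g :: "real \<Rightarrow> real"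
  assumes f: "\<And>x. x \<in> S \<Longrightarrow> (f has_vector_derivative f' x) (at x within S)"
    and nz: "\<And>x. x \<in> S \<Longrightarrow> f' x \<noteq> 0"
    and g: "\<And>x. x \<in> S \<Longrightarrow> g (f x) = x" and "compact S" and y: "y \<in> f ` S"
  shows "(g has_vector_derivative 1 / f' (g y)) (at y within f ` S)"
proof -
  have cg: "continuous_on (f ` S) g"
    by (rule continuous_on_inv[OF continuous_on_vector_derivative[OF f] \<open>compact S\<close>]) (use g in auto)
  have gy: "g y \<in> S" "f (g y) = y" using y g by auto
  \<comment> \<open>The limit of the difference quotient of f excludes the base point; injectivity
    ensures g(x) \<noteq> g(y) for x \<noteq> y, so that the limits can be composed.\<close>
  have "filterlim g (at (g y) within S) (at y within f ` S)"
    unfolding filterlim_at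
  proof
    show "\<forall>\<^sub>F x in at y within f ` S. g x \<in> S \<and> g x \<noteq> g y"
      unfolding eventually_at_filter using g gy by (auto intro!: always_eventually)
    show "(g \<longlongrightarrow> g y) (at y within f ` S)"
      using cg y unfolding continuous_on by blast
  qed
  moreover have "((\<lambda>x. (f x - f (g y)) / (x - g y)) \<longlongrightarrow> f' (g y)) (at (g y) within S)"
    using f[OF gy(1)]
    by (simp add: has_field_derivative_iff flip: has_real_derivative_iff_has_vector_derivative)
  ultimately have "((\<lambda>x. (f (g x) - f (g y)) / (g x - g y)) \<longlongrightarrow> f' (g y)) (at y within f ` S)"
    by (rule filterlim_compose[rotated])
  then have "((\<lambda>x. inverse ((f (g x) - f (g y)) / (g x - g y))) \<longlongrightarrow> inverse (f' (g y))) (at y within f ` S)"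
    by (rule tendsto_inverse) (use nz gy in auto)
  moreover have "\<forall>\<^sub>F x in at y within f ` S.
      inverse ((f (g x) - f (g y)) / (g x - g y)) = (g x - g y) / (x - y)"
    unfolding eventually_at_filter using g gy by (auto intro!: always_eventually)
  ultimately have "((\<lambda>x. (g x - g y) / (x - y)) \<longlongrightarrow> inverse (f' (g y))) (at y within f ` S)"
    by (rule Lim_transform_eventually)
  then show ?thesis
    by (simp add: has_field_derivative_iff inverse_eq_divide flip: has_real_derivative_iff_has_vector_derivative)
qed

section \<open>Calculus of C^1 functions relative to a set\<close>

lemma class_C_1_iff:
  "class_C 1 S f \<longleftrightarrow>
     (\<exists>f'. (\<forall>x\<in>S. (f has_vector_derivative f' x) (at x within S)) \<and> continuous_on S f')"
  by simp

lemma class_C_1I: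
  assumes "\<And>x. x \<in> S \<Longrightarrow> (f has_vector_derivative f' x) (at x within S)" "continuous_on S f'"
  shows "class_C 1 S f"
  using assms unfolding class_C_1_iff by blast

lemma class_C_1E:
  assumes "class_C 1 S f"
  obtains f' where "\<And>x. x \<in> S \<Longrightarrow> (f has_vector_derivative f' x) (at x within S)"
    "continuous_on S f'" "continuous_on S f"
  using assms continuous_on_vector_derivative unfolding class_C_1_iff by metis

lemma class_C_1_continuous: "class_C 1 S f \<Longrightarrow> continuous_on S f"
  by (erule class_C_1E)

lemma class_C_1_of_Suc: "class_C (Suc n) S f \<Longrightarrow> class_C 1 S f"
proof (induction n arbitrary: f)
  case (Suc n)
  then obtain f' where "\<forall>x\<in>S. (f has_vector_derivative f' x) (at x within S)" "class_C (Suc n) S f'"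
    by auto
  moreover have "continuous_on S f'"
    by (rule class_C_1_continuous[OF Suc.IH[OF calculation(2)]])
  ultimately show ?case by auto
qed simp

lemma class_C_1_cong:
  assumes "class_C 1 S f" "\<And>x. x \<in> S \<Longrightarrow> f x = g x"
  shows "class_C 1 S g"
proof -
  obtain f' where f: "\<And>x. x \<in> S \<Longrightarrow> (f has_vector_derivative f' x) (at x within S)"
    "continuous_on S f'"
    using class_C_1E[OF assms(1)] by metis
  show ?thesis
    by (rule class_C_1I[OF has_vector_derivative_transform[OF _ _ f(1)] f(2)]) (use assms(2) in auto)
qed

lemma class_C_1_scaleR:
  assumes "class_C 1 S f" "class_C 1 S g"
  shows "class_C 1 S (\<lambda>x. f x *\<^sub>R g x)"
proof -
  obtain f' where f: "\<And>x. x \<in> S \<Longrightarrow> (f has_vector_derivative f' x) (at x within S)"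
    "continuous_on S f'" "continuous_on S f"
    using class_C_1E[OF assms(1)] by metis
  obtain g' where g: "\<And>x. x \<in> S \<Longrightarrow> (g has_vector_derivative g' x) (at x within S)"
    "continuous_on S g'" "continuous_on S g"
    using class_C_1E[OF assms(2)] by metis
  show ?thesis
    by (rule class_C_1I[of _ _ "\<lambda>x. f x *\<^sub>R g' x + f' x *\<^sub>R g x"])
       (auto intro!: has_vector_derivative_scaleR f g continuous_intros
         simp: has_real_derivative_iff_has_vector_derivative)
qed

lemma class_C_1_mult:
  fixes f g :: "real \<Rightarrow> real"
  shows "class_C 1 S f \<Longrightarrow> class_C 1 S g \<Longrightarrow> class_C 1 S (\<lambda>x. f x * g x)"
  using class_C_1_scaleR[of S f g] by simp

lemma class_C_1_const: "class_C 1 S (\<lambda>x. c)"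
  by (rule class_C_1I[of _ _ "\<lambda>x. 0"]) auto

lemma class_C_1_compose:
  assumes f: "class_C 1 T f" and g: "class_C 1 S g" and "g ` S \<subseteq> T"
  shows "class_C 1 S (\<lambda>x. f (g x))"
proof -
  obtain f' where f': "\<And>x. x \<in> T \<Longrightarrow> (f has_vector_derivative f' x) (at x within T)"
    "continuous_on T f'" "continuous_on T f"
    using class_C_1E[OF f] by metis
  obtain g' where g': "\<And>x. x \<in> S \<Longrightarrow> (g has_vector_derivative g' x) (at x within S)"
    "continuous_on S g'" "continuous_on S g"
    using class_C_1E[OF g] by metis
  show ?thesis
  proof (rule class_C_1I[of _ _ "\<lambda>x. g' x *\<^sub>R f' (g x)"])
    fix x assume x: "x \<in> S"
    have "(f \<circ> g has_vector_derivative g' x *\<^sub>R f' (g x)) (at x within S)"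
    proof (rule vector_diff_chain_within[OF g'(1)[OF x]])
      show "(f has_vector_derivative f' (g x)) (at (g x) within g ` S)"
        by (rule has_vector_derivative_within_subset[OF f'(1)]) (use assms(3) x in auto)
    qed
    then show "((\<lambda>x. f (g x)) has_vector_derivative g' x *\<^sub>R f' (g x)) (at x within S)"
      by (simp add: comp_def)
  next
    show "continuous_on S (\<lambda>x. g' x *\<^sub>R f' (g x))"
      by (intro continuous_intros g' continuous_on_compose2[OF f'(2)]) (use assms in auto)
  qed
qed

lemma has_vector_derivative_powr_positive:
  fixes f f' :: "real \<Rightarrow> real"
  assumes "(f has_vector_derivative f' x) (at x within S)" "f x > 0"
  shows "((\<lambda>x. f x powr a) has_vector_derivative a * f x powr (a - 1) * f' x) (at x within S)"
proof -
  have "((\<lambda>x. f x powr a) has_real_derivative a * f x powr (a - 1) * f' x) (at x within S)"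
    by (rule DERIV_chain2[OF has_real_derivative_powr])
       (use assms in \<open>auto simp: has_real_derivative_iff_has_vector_derivative\<close>)
  then show ?thesis by (simp add: has_real_derivative_iff_has_vector_derivative)
qed

lemma class_C_1_powr:
  fixes f :: "real \<Rightarrow> real"
  assumes "class_C 1 S f" and pos: "\<And>x. x \<in> S \<Longrightarrow> f x > 0"
  shows "class_C 1 S (\<lambda>x. f x powr a)"
proof -
  obtain f' where f: "\<And>x. x \<in> S \<Longrightarrow> (f has_vector_derivative f' x) (at x within S)"
    "continuous_on S f'" "continuous_on S f"
    using class_C_1E[OF assms(1)] by metis
  show ?thesis
    by (rule class_C_1I[OF has_vector_derivative_powr_positive[where f' = f']])
       (use f pos in \<open>auto intro!: continuous_intros simp: less_imp_neq[symmetric] dest: pos\<close>)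
qed

text \<open>
  The coordinate \<open>y\<close> with \<open>x = p\<^sub>j + side_sign j * y\<close> moves either endpoint to \<open>y = 0\<close> and \<open>q\<close> to
  \<open>y = L\<close>; the factors of \<open>\<psi>'\<close> and \<open>U\<close> belonging to the other endpoint are absorbed into \<open>w\<close>
  and \<open>v\<close>.
\<close>

locale phase_endpoint =
  fixes p \<rho> \<mu> :: "nat \<Rightarrow> real" and \<psi> :: "real \<Rightarrow> real" and U :: "real \<Rightarrow> complex"
    and q :: real and j :: nat and L :: real and w :: "real \<Rightarrow> real" and v :: "real \<Rightarrow> complex"
  assumes j: "j \<in> {1, 2}" and rho: "\<rho> j \<ge> 1" and mu: "0 < \<mu> j" "\<mu> j < 1"
    and L: "L > 0" and q: "q = p j + side_sign j * L"
    and phase_deriv: "\<And>y. y \<in> {0..L} \<Longrightarrow>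
      ((\<lambda>y. side_sign j * (\<psi> (p j + side_sign j * y) - \<psi> (p j))) has_vector_derivative
        rpow y (\<rho> j - 1) * w y) (at y within {0..L})"
    and w: "class_C 1 {0..L} w" and w_pos: "\<And>y. y \<in> {0..L} \<Longrightarrow> w y > 0"
    and amplitude: "\<And>y. y \<in> {0<..L} \<Longrightarrow>
      U (p j + side_sign j * y) = y powr (\<mu> j - 1) *\<^sub>R v y"
    and v: "class_C 1 {0..L} v"
begin

abbreviation sg :: real where "sg \<equiv> side_sign j"
abbreviation x_of :: "real \<Rightarrow> real" where "x_of y \<equiv> p j + sg * y"
abbreviation S :: real where "S \<equiv> s_end p \<rho> \<psi> q j"
abbreviation f :: "real \<Rightarrow> real" where "f y \<equiv> phi p \<rho> \<psi> j (x_of y)"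
abbreviation g :: "real \<Rightarrow> real" where "g \<equiv> the_inv_into {0..L} f"
abbreviation k :: "real \<Rightarrow> complex" where "k \<equiv> k_fun p \<rho> \<mu> \<psi> U q j"
abbreviation k' :: "real \<Rightarrow> complex" where "k' \<equiv> k_deriv p \<rho> \<mu> \<psi> U q j"

text \<open>The sign makes h increase away from either endpoint: it is \<psi> - \<psi>(p_1) for j =
  1 and \<psi>(p_2) - \<psi> for j = 2, so \<open>phi\<close> is its power 1/\<rho> in both
  cases.\<close>

definition h :: "real \<Rightarrow> real" where "h y = sg * (\<psi> (x_of y) - \<psi> (p j))"

lemmas sg_cases = side_sign_cases[of j]

lemma sg_sq: "sg * (sg * x) = x"
  using sg_cases by auto

lemma phi_h: "f y = h y powr (1 / \<rho> j)"
  using j by (auto simp: phi_def h_def side_sign_def)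

lemma phase_eq: "\<psi> (x_of y) = \<psi> (p j) + sg * h y"
  unfolding h_def sg_sq by simp

lemma S_eq: "S = f L"
  by (simp add: s_end_def q)

lemma I_sub_eq: "I_sub p q j = x_of ` {0..L}"
proof (cases "j = 1")
  case True
  have "x_of ` {0..L} = (+) (p 1) ` {0..L}" using True by (simp add: side_sign_def)
  then show ?thesis using True q by (simp add: I_sub_def side_sign_def)
next
  case False
  then have j2: "j = 2" using j by simp
  have "x_of ` {0..L} = (-) (p 2) ` {0..L}" using j2 by (simp add: side_sign_def)
  then show ?thesis using j2 q by (simp add: I_sub_def side_sign_def)
qed

end

section \<open>Regularity of the change of variable and of the amplitude k\<close>

locale phase_factor = phase_endpoint +
  fixes W :: "real \<Rightarrow> real"
  assumes W: "class_C 1 {0..L} W" and W_pos: "\<And>y. y \<in> {0..L} \<Longrightarrow> W y > 0"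
    and h_factor: "\<And>y. y \<in> {0..L} \<Longrightarrow> h y = y powr \<rho> j * W y"
    and W_ode: "\<And>y W'. y \<in> {0..L} \<Longrightarrow> (W has_vector_derivative W') (at y within {0..L}) \<Longrightarrow>
       \<rho> j * W y + y * W' = w y"
begin

text \<open>The derivative of f. Differentiating y W(y)^(1/\<rho>) produces W', which
  \<open>W_ode\<close> eliminates; the result involves only W and w, hence is visibly positive and
  C^1 up to y = 0.\<close>

definition D :: "real \<Rightarrow> real" where
  "D y = 1 / \<rho> j * (W y powr (1 / \<rho> j - 1) * w y)"

text \<open>Up to the sign \<open>sg\<close>, this is k at s = f(y). Since s = y W(y)^(1/\<rho>),
  the singular factor y^(\<mu>-1) of U cancels against s^(1-\<mu>) and leaves W^((1-\<mu>)/\<rho>),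
  which is regular at y = 0.\<close>

definition K :: "real \<Rightarrow> complex" where
  "K y = (W y powr ((1 - \<mu> j) / \<rho> j) * D y powr (- 1)) *\<^sub>R v y"

lemma D_pos: "y \<in> {0..L} \<Longrightarrow> D y > 0"
  using W_pos[of y] w_pos[of y] rho by (simp add: D_def)

lemma D_C1: "class_C 1 {0..L} D"
  unfolding D_def[abs_def] by (intro class_C_1_mult class_C_1_const class_C_1_powr W W_pos w)

lemma K_C1: "class_C 1 {0..L} K"
  unfolding K_def[abs_def]
  by (intro class_C_1_mult class_C_1_scaleR class_C_1_powr W W_pos D_C1 D_pos v)

lemma f_eq: "y \<in> {0..L} \<Longrightarrow> f y = y * W y powr (1 / \<rho> j)"
  using W_pos[of y] rho by (simp add: phi_h h_factor powr_mult powr_powr)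

lemma f_deriv:
  assumes y: "y \<in> {0..L}"
  shows "(f has_vector_derivative D y) (at y within {0..L})"
proof -
  obtain W' where W': "\<And>y. y \<in> {0..L} \<Longrightarrow> (W has_vector_derivative W' y) (at y within {0..L})"
    using class_C_1E[OF W] by metis
  have "((\<lambda>y. y * W y powr (1 / \<rho> j)) has_vector_derivative
      (y * (1 / \<rho> j * W y powr (1 / \<rho> j - 1) * W' y) + 1 * W y powr (1 / \<rho> j))) (at y within {0..L})"
    by (intro has_vector_derivative_mult has_vector_derivative_id
        has_vector_derivative_powr_positive W' W_pos y)
  moreover have "y * (1 / \<rho> j * W y powr (1 / \<rho> j - 1) * W' y) + 1 * W y powr (1 / \<rho> j) = D y"
  proof -
    \<comment> \<open>Taking out W^(1/\<rho> - 1) leaves W + y W' / \<rho>, which is w /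
      \<rho>.\<close>
    have "W y powr (1 / \<rho> j) = W y * W y powr (1 / \<rho> j - 1)"
      using W_pos[OF y] powr_mult_base[of "W y" "1 / \<rho> j - 1"] by simp
    then show ?thesis
      using rho unfolding D_def W_ode[OF y W'[OF y], symmetric] by (simp add: field_simps)
  qed
  ultimately have "((\<lambda>y. y * W y powr (1 / \<rho> j)) has_vector_derivative D y) (at y within {0..L})"
    by simp
  then show ?thesis
    by (rule has_vector_derivative_transform[OF y f_eq, rotated])
qed

lemma f_cont: "continuous_on {0..L} f"
  by (rule continuous_on_vector_derivative[OF f_deriv])

lemma f_less:
  assumes "0 \<le> a" "a < b" "b \<le> L"
  shows "f a < f b"
proof (rule DERIV_pos_imp_increasing_open[OF assms(2)])
  fix x assume x: "a < x" "x < b"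
  have "(f has_real_derivative D x) (at x)"
    using f_deriv[of x] x assms at_within_interior[of x "{0..L}"]
    by (simp add: has_real_derivative_iff_has_vector_derivative)
  then show "\<exists>y. (f has_real_derivative y) (at x) \<and> 0 < y"
    using D_pos[of x] x assms by auto
qed (use assms in \<open>auto intro!: continuous_on_subset[OF f_cont]\<close>)

lemma f_mono: "0 \<le> a \<Longrightarrow> a \<le> b \<Longrightarrow> b \<le> L \<Longrightarrow> f a \<le> f b"
  using f_less[of a b] by (cases "a = b") auto

lemma f_inj: "inj_on f {0..L}"
proof (rule inj_onI)
  fix a b assume "a \<in> {0..L}" "b \<in> {0..L}" and eq: "f a = f b"
  then show "a = b"
    using f_less[of a b] f_less[of b a] by (cases a b rule: linorder_cases) auto
qed

lemma f_0: "f 0 = 0"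
  using f_eq[of 0] L by simp

lemma S_pos: "S > 0"
  using f_less[of 0 L] f_0 L by (simp add: S_eq)

lemma f_image: "f ` {0..L} = {0..S}"
proof (intro equalityI subsetI)
  fix s assume "s \<in> f ` {0..L}"
  then obtain y where y: "y \<in> {0..L}" "s = f y" by auto
  then have "f 0 \<le> f y" "f y \<le> f L" using f_mono[of 0 y] f_mono[of y L] by auto
  then show "s \<in> {0..S}" using y f_0 by (simp add: S_eq)
next
  fix s assume "s \<in> {0..S}"
  then show "s \<in> f ` {0..L}"
    using IVT'[of f 0 s L] f_0 f_cont L by (auto simp: S_eq)
qed

lemma g_f: "y \<in> {0..L} \<Longrightarrow> g (f y) = y"
  by (rule the_inv_into_f_f[OF f_inj])

lemma g_in: "s \<in> {0..S} \<Longrightarrow> g s \<in> {0..L}"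
  unfolding f_image[symmetric] by (elim imageE) (simp add: g_f)

lemma f_g: "s \<in> {0..S} \<Longrightarrow> f (g s) = s"
  unfolding f_image[symmetric] by (elim imageE) (simp add: g_f)

lemma g_deriv:
  assumes "s \<in> {0..S}"
  shows "(g has_vector_derivative 1 / D (g s)) (at s within {0..S})"
proof -
  have "(g has_vector_derivative 1 / D (g s)) (at s within f ` {0..L})"
  proof (rule inverse_has_vector_derivative_within[OF f_deriv _ g_f compact_Icc])
    show "D x \<noteq> 0" if "x \<in> {0..L}" for x using D_pos[OF that] by simp
  qed (use assms f_image in auto)
  then show ?thesis by (simp only: f_image)
qed

lemma g_C1: "class_C 1 {0..S} g"
proof (rule class_C_1I[OF g_deriv])
  have "continuous_on {0..S} (\<lambda>s. D (g s))"
    by (rule continuous_on_compose2[OF class_C_1_continuous[OF D_C1] continuous_on_vector_derivative[OF g_deriv]])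
       (use g_in in auto)
  moreover have "D (g s) \<noteq> 0" if "s \<in> {0..S}" for s
    using D_pos[OF g_in[OF that]] by simp
  ultimately show "continuous_on {0..S} (\<lambda>s. 1 / D (g s))"
    by (intro continuous_on_divide continuous_on_const) auto
qed

lemma phi_inv_eq:
  assumes "s \<in> {0..S}"
  shows "phi_inv p \<rho> \<psi> q j s = x_of (g s)"
  unfolding phi_inv_def
proof (rule the_inv_into_f_eq)
  have "inj_on (phi p \<rho> \<psi> j) (x_of ` {0..L})"
    using f_inj inj_on_imageI[of "phi p \<rho> \<psi> j" x_of "{0..L}"] by (simp add: comp_def)
  then show "inj_on (phi p \<rho> \<psi> j) (I_sub p q j)" by (simp add: I_sub_eq)
  show "phi p \<rho> \<psi> j (x_of (g s)) = s" by (rule f_g[OF assms])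
  show "x_of (g s) \<in> I_sub p q j" unfolding I_sub_eq by (rule imageI[OF g_in[OF assms]])
qed

lemma phi_inv_deriv:
  assumes "s \<in> {0..S}"
  shows "vector_derivative (phi_inv p \<rho> \<psi> q j) (at s within {0..S}) = sg / D (g s)"
proof (rule vector_derivative_within_closed_interval)
  have "((\<lambda>s. x_of (g s)) has_vector_derivative 0 + sg * (1 / D (g s))) (at s within {0..S})"
    by (intro has_vector_derivative_add has_vector_derivative_const has_vector_derivative_mult_right
        g_deriv assms)
  then show "(phi_inv p \<rho> \<psi> q j has_vector_derivative sg / D (g s)) (at s within {0..S})"
    using has_vector_derivative_transform[OF assms phi_inv_eq] by simp
qed (use assms S_pos in auto)

lemma k_pre_eq:
  assumes s: "s \<in> {0<..S}"
  shows "k_pre p \<rho> \<mu> \<psi> U q j s = (sg * (s powr (1 - \<mu> j) / D (g s))) *\<^sub>R U (x_of (g s))"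
proof -
  have "s \<in> {0..S}" using s by auto
  then show ?thesis
    unfolding k_pre_def phi_inv_deriv[OF \<open>s \<in> {0..S}\<close>]
    by (simp add: phi_inv_eq scaleR_conv_of_real)
qed

lemma k_pre_K:
  assumes s: "s \<in> {0<..S}"
  shows "k_pre p \<rho> \<mu> \<psi> U q j s = sg *\<^sub>R K (g s)"
proof -
  have s': "s \<in> {0..S}" using s by auto
  define y where "y = g s"
  have y: "y \<in> {0..L}" "f y = s" using g_in[OF s'] f_g[OF s'] by (auto simp: y_def)
  have y0: "y > 0" using y s f_0 by (cases "y = 0") auto
  have "s powr (1 - \<mu> j) * y powr (\<mu> j - 1) = W y powr ((1 - \<mu> j) / \<rho> j)"
  proof -
    have "s powr (1 - \<mu> j) = y powr (1 - \<mu> j) * W y powr ((1 - \<mu> j) / \<rho> j)"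
      unfolding y(2)[symmetric] f_eq[OF y(1)] using y0 W_pos[OF y(1)]
      by (simp add: powr_mult powr_powr)
    moreover have "y powr (1 - \<mu> j) * y powr (\<mu> j - 1) = 1"
      using y0 by (simp flip: powr_add)
    ultimately show ?thesis by (simp add: mult_ac)
  qed
  moreover have "U (x_of y) = y powr (\<mu> j - 1) *\<^sub>R v y"
    using amplitude y y0 by simp
  ultimately have "sg * (s powr (1 - \<mu> j) / D y) * y powr (\<mu> j - 1) =
      sg * (W y powr ((1 - \<mu> j) / \<rho> j) * D y powr (- 1))" and "U (x_of y) = y powr (\<mu> j - 1) *\<^sub>R v y"
    using D_pos[OF y(1)] by (simp_all add: powr_minus_divide)
  then show ?thesis
    unfolding k_pre_eq[OF s] y_def[symmetric] K_def by (simp only: scaleR_scaleR)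
qed

lemma k_K:
  assumes s: "s \<in> {0..S}"
  shows "k s = sg *\<^sub>R K (g s)"
proof (cases "s = 0")
  case True
  \<comment> \<open>By definition k(0) is a limit from the right; continuity of K composed with g
    shows that it exists and evaluates it.\<close>
  have "class_C 1 {0..S} (\<lambda>s. K (g s))"
    by (rule class_C_1_compose[OF K_C1 g_C1]) (use g_in in auto)
  then have "continuous_on {0..S} (\<lambda>s. K (g s))"
    by (rule class_C_1_continuous)
  then have "((\<lambda>s. K (g s)) \<longlongrightarrow> K (g 0)) (at 0 within {0..S})"
    using S_pos by (simp add: continuous_on)
  then have "((\<lambda>s. K (g s)) \<longlongrightarrow> K (g 0)) (at_right 0)"
    by (simp only: at_within_Icc_at_right[OF S_pos])
  then have "((\<lambda>s. sg *\<^sub>R K (g s)) \<longlongrightarrow> sg *\<^sub>R K (g 0)) (at_right 0)"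
    by (intro tendsto_intros)
  moreover have "\<forall>\<^sub>F s in at_right 0. sg *\<^sub>R K (g s) = k_pre p \<rho> \<mu> \<psi> U q j s"
    using S_pos unfolding eventually_at_right[OF S_pos] by (intro exI[of _ S]) (simp add: k_pre_K)
  ultimately have "(k_pre p \<rho> \<mu> \<psi> U q j \<longlongrightarrow> sg *\<^sub>R K (g 0)) (at_right 0)"
    by (rule Lim_transform_eventually)
  then show ?thesis
    using True by (simp add: k_fun_def tendsto_Lim)
next
  case False
  then show ?thesis using s k_pre_K[of s] by (simp add: k_fun_def)
qed

text \<open>Unlike \<open>k_K\<close>, this form keeps U explicit, as is required for recovering the
  original integrand and the value U(q).\<close>

lemma k_f:
  assumes y: "y \<in> {0<..L}"
  shows "k (f y) = (sg * (f y powr (1 - \<mu> j) / D y)) *\<^sub>R U (x_of y)"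
proof -
  have y': "y \<in> {0..L}" "f y \<in> {0<..S}"
    using y f_less[of 0 y] f_0 f_image by auto
  then show ?thesis
    using k_pre_eq[OF y'(2)] g_f[OF y'(1)] by (simp add: k_fun_def)
qed

lemma k_C1: "class_C 1 {0..S} k"
proof (rule class_C_1_cong)
  show "class_C 1 {0..S} (\<lambda>s. sg *\<^sub>R K (g s))"
    by (intro class_C_1_scaleR class_C_1_const class_C_1_compose[OF K_C1 g_C1])
       (use g_in in auto)
qed (simp add: k_K)

lemma
  shows k_deriv: "s \<in> {0..S} \<Longrightarrow> (k has_vector_derivative k' s) (at s within {0..S})"
    and k_deriv_cont: "continuous_on {0..S} k'"
    and k_cont: "continuous_on {0..S} k"
proof -
  obtain l where l: "\<And>s. s \<in> {0..S} \<Longrightarrow> (k has_vector_derivative l s) (at s within {0..S})"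
    "continuous_on {0..S} l" "continuous_on {0..S} k"
    using class_C_1E[OF k_C1] by metis
  have eq: "k' s = l s" if "s \<in> {0..S}" for s
    unfolding k_deriv_def
    by (rule vector_derivative_within_closed_interval[OF S_pos that l(1)[OF that]])
  then show "(k has_vector_derivative k' s) (at s within {0..S})" if "s \<in> {0..S}"
    using l(1)[OF that] that by simp
  show "continuous_on {0..S} k'"
    by (rule continuous_on_eq[OF l(2) eq[symmetric]])
  show "continuous_on {0..S} k" by (rule l(3))
qed

text \<open>Both sides are h'(y), computed once from h = f^\<rho> and once from the shape of
  \<psi>'. At y = L this relates the derivative of \<open>phi\<close> at q to \<psi>'(q).\<close>

lemma f_powr_D:
  assumes y: "y \<in> {0<..L}"
  shows "\<rho> j * f y powr (\<rho> j - 1) * D y = y powr (\<rho> j - 1) * w y"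
proof -
  have y': "y \<in> {0..L}" using y by auto
  have "f y powr (\<rho> j - 1) = y powr (\<rho> j - 1) * W y powr ((\<rho> j - 1) / \<rho> j)"
    unfolding f_eq[OF y'] using y W_pos[OF y'] by (simp add: powr_mult powr_powr)
  moreover have "W y powr ((\<rho> j - 1) / \<rho> j) * W y powr (1 / \<rho> j - 1) = 1"
    using W_pos[OF y'] rho by (simp add: field_simps flip: powr_add)
  moreover have "\<rho> j * (y powr (\<rho> j - 1) * B) * (1 / \<rho> j * (C * w y)) = (B * C) * (y powr (\<rho> j - 1) * w y)"
    for B C using rho by simp
  ultimately show ?thesis by (simp only: D_def mult_1_left)
qed

lemma f_powr_rho: "y \<in> {0..L} \<Longrightarrow> f y powr \<rho> j = h y"
  using W_pos[of y] rho by (simp add: phi_h h_factor powr_powr)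

lemma phi_deriv_q:
  "vector_derivative (phi p \<rho> \<psi> j) (at q within I_sub p q j) = sg * D L"
proof -
  have "((\<lambda>y. f y) \<circ> (\<lambda>x. sg * (x - p j)) has_vector_derivative sg *\<^sub>R D L) (at q within I_sub p q j)"
  proof (rule vector_diff_chain_within)
    show "((\<lambda>x. sg * (x - p j)) has_vector_derivative sg) (at q within I_sub p q j)"
      by (auto intro!: derivative_eq_intros)
    have "(\<lambda>x. sg * (x - p j)) ` I_sub p q j = {0..L}"
      unfolding I_sub_eq image_image by (simp add: sg_sq)
    moreover have "sg * (q - p j) = L" by (simp add: q sg_sq)
    ultimately show "((\<lambda>y. f y) has_vector_derivative D L)
       (at (sg * (q - p j)) within (\<lambda>x. sg * (x - p j)) ` I_sub p q j)"
      using f_deriv[of L] L by simp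
  qed
  then have "(phi p \<rho> \<psi> j has_vector_derivative sg * D L) (at q within I_sub p q j)"
    by (simp add: comp_def sg_sq)
  moreover obtain a b where ab: "a < b" "q \<in> {a..b}" "I_sub p q j = {a..b}"
    using L q j that[of "p 1" q] that[of q "p 2"]
    by (cases "j = 1") (auto simp: I_sub_def side_sign_def)
  ultimately show ?thesis
    unfolding ab(3) by (intro vector_derivative_within_closed_interval[OF ab(1,2)])
qed

end

context phase_endpoint
begin

lemma phase_factor_exists:
  obtains W where "phase_factor p \<rho> \<mu> \<psi> U q j L w v W"
proof -
  obtain w' where w': "\<And>y. y \<in> {0..L} \<Longrightarrow> (w has_vector_derivative w' y) (at y within {0..L})"
    "continuous_on {0..L} w'"
    using class_C_1E[OF w] by metis
  have h: "(h has_vector_derivative rpow y (\<rho> j - 1) * w y) (at y within {0..L})" if "y \<in> {0..L}" for y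
    using phase_deriv[OF that] by (simp add: h_def[abs_def])
  have h0: "h 0 = 0" by (simp add: h_def)
  show thesis
  proof (rule power_phase_factorization[OF rho h h0 w' w_pos])
    fix W W' assume W: "\<And>y. y \<in> {0..L} \<Longrightarrow> (W has_vector_derivative W' y) (at y within {0..L})"
      "continuous_on {0..L} W'" "\<And>y. y \<in> {0..L} \<Longrightarrow> W y > 0"
      "\<And>y. y \<in> {0..L} \<Longrightarrow> h y = y powr \<rho> j * W y"
      "\<And>y. y \<in> {0..L} \<Longrightarrow> \<rho> j * W y + y * W' y = w y"
    have "phase_factor p \<rho> \<mu> \<psi> U q j L w v W"
    proof unfold_locales
      show "class_C 1 {0..L} W" by (rule class_C_1I[OF W(1,2)])
      fix y V assume y: "y \<in> {0..L}" and V: "(W has_vector_derivative V) (at y within {0..L})"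
      \<comment> \<open>Derivatives relative to a nondegenerate interval are unique, so the identity
        for W' holds for any derivative value V.\<close>
      have "V = W' y"
        using vector_derivative_within_closed_interval[OF L y V]
          vector_derivative_within_closed_interval[OF L y W(1)[OF y]] by simp
      then show "\<rho> j * W y + y * V = w y" using W(5)[OF y] by simp
    qed (use W in auto)
    then show thesis by (rule that)
  qed
qed

end

section \<open>Contribution of one endpoint\<close>

locale endpoint_expansion = phase_factor + ray: steepest_ray \<rho> j \<omega> for \<omega>
begin

abbreviation \<Phi> :: "real \<Rightarrow> complex" where "\<Phi> s \<equiv> phi_osc \<rho> \<mu> j s \<omega>"

abbreviation \<epsilon> :: complex where "\<epsilon> \<equiv> exp (\<i> * of_real (\<omega> * \<psi> (p j)))"

text \<open>Integration by parts in the form of an antiderivative: removing \<Phi> k' from the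
  derivative of \<Phi> k leaves s^(\<mu>-1) exp(i sg \<omega> s^\<rho>) k(s). H is continuous on all
  of [0, S] in spite of the singular factor at 0.\<close>

definition H :: "real \<Rightarrow> complex" where
  "H s = \<Phi> s * k s - integral {0..s} (\<lambda>s. \<Phi> s * k' s)"

lemma Phi_eq: "\<Phi> s = - Lambda_integral \<rho> j s (ray.pw (\<mu> j - 1))"
  by (simp add: phi_osc_def ray.pw_def[abs_def] ray.osc_def)

lemma Phi_deriv:
  assumes "s > 0"
  shows "(\<Phi> has_vector_derivative ray.pw (\<mu> j - 1) (of_real s)) (at s)"
  using has_vector_derivative_minus[OF ray.Lambda_integral_pw_deriv[of "\<mu> j - 1" s]] mu assms
  by (simp add: Phi_eq[abs_def])

lemma Phi_cont: "continuous_on {0..} \<Phi>"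
  unfolding continuous_on_eq_continuous_within
proof
  fix s :: real assume "s \<in> {0..}"
  then consider "s = 0" | "s > 0" by force
  then show "continuous (at s within {0..}) \<Phi>"
  proof cases
    case 1
    have "(\<Phi> \<longlongrightarrow> \<Phi> 0) (at_right 0)"
      unfolding Phi_eq by (intro tendsto_minus ray.Lambda_integral_pw_continuous_at_0 mu)
    then show ?thesis
      using 1 by (simp add: continuous_within at_within_Ici_at_right)
  next
    case 2
    then show ?thesis
      by (rule continuous_at_imp_continuous_at_within[OF has_vector_derivative_continuous[OF Phi_deriv]])
  qed
qed

lemma norm_Phi: "s > 0 \<Longrightarrow> norm (\<Phi> s) \<le> s powr (\<mu> j - 1) * ray.decay_const"
  using ray.norm_Lambda_integral_pw[of "\<mu> j - 1" s] mu by (simp add: Phi_eq)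

lemma Phi_k'_cont: "continuous_on {0..S} (\<lambda>s. \<Phi> s * k' s)"
  by (intro continuous_on_mult continuous_on_subset[OF Phi_cont] k_deriv_cont) auto

lemma H_cont: "continuous_on {0..S} H"
  unfolding H_def[abs_def]
  by (intro continuous_on_diff continuous_on_mult continuous_on_subset[OF Phi_cont] k_cont
      indefinite_integral_continuous_1 integrable_continuous_interval Phi_k'_cont) auto

lemma H_deriv:
  assumes s: "s \<in> {0<..<S}"
  shows "(H has_vector_derivative ray.pw (\<mu> j - 1) (of_real s) * k s) (at s)"
proof -
  have at: "at s within {0..S} = at s"
    using s by (intro at_within_interior) auto
  have "(H has_vector_derivative (\<Phi> s * k' s + ray.pw (\<mu> j - 1) (of_real s) * k s) - \<Phi> s * k' s)
     (at s within {0..S})"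
    unfolding H_def[abs_def]
  proof (intro has_vector_derivative_diff has_vector_derivative_mult
      integral_has_vector_derivative[OF Phi_k'_cont] k_deriv)
    show "(\<Phi> has_vector_derivative ray.pw (\<mu> j - 1) (of_real s)) (at s within {0..S})"
      by (rule has_vector_derivative_at_within[OF Phi_deriv]) (use s in auto)
  qed (use s in auto)
  then show ?thesis by (simp add: at)
qed

text \<open>Under s = f(y) the powers s^(\<mu>-1) and s^(1-\<mu>) cancel, D cancels the derivative
  of the inverse, the two signs cancel, and \<psi>(x) = \<psi>(p_j) + sg s^\<rho> reassembles the
  exponential.\<close>

lemma integrand_pullback:
  assumes y: "y \<in> {0<..<L}"
  shows "of_real sg * \<epsilon> * (D y *\<^sub>R (ray.pw (\<mu> j - 1) (of_real (f y)) * k (f y))) =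
     U (x_of y) * exp (\<i> * of_real (\<omega> * \<psi> (x_of y)))"
proof -
  have y': "y \<in> {0<..L}" "y \<in> {0..L}" using y by auto
  have fy: "f y > 0" using f_less[of 0 y] f_0 y by auto
  have a: "sg * (D y * (f y powr (\<mu> j - 1) * (sg * (f y powr (1 - \<mu> j) / D y)))) = 1"
  proof -
    have "f y powr (\<mu> j - 1) * f y powr (1 - \<mu> j) = 1" using fy by (simp flip: powr_add)
    then have "D y * (f y powr (\<mu> j - 1) * (f y powr (1 - \<mu> j) / D y)) = 1"
      using D_pos[OF y'(2)] by (simp add: field_simps)
    then have "sg * (sg * (D y * (f y powr (\<mu> j - 1) * (f y powr (1 - \<mu> j) / D y)))) = 1"
      unfolding sg_sq .
    then show ?thesis by (simp only: mult_ac times_divide_eq_right)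
  qed
  have "\<epsilon> * exp (\<i> * of_real (sg * \<omega> * f y powr \<rho> j)) = exp (\<i> * of_real (\<omega> * \<psi> (x_of y)))"
    unfolding f_powr_rho[OF y'(2)] phase_eq exp_add[symmetric] by (simp add: algebra_simps)
  moreover have "of_real sg * \<epsilon> * (D y *\<^sub>R (ray.pw (\<mu> j - 1) (of_real (f y)) * k (f y))) =
     of_real (sg * (D y * (f y powr (\<mu> j - 1) * (sg * (f y powr (1 - \<mu> j) / D y))))) *
     (U (x_of y) * (\<epsilon> * exp (\<i> * of_real (sg * \<omega> * f y powr \<rho> j))))"
    using fy unfolding k_f[OF y'(1)]
    by (simp add: ray.pw_of_real scaleR_conv_of_real mult_ac)
  ultimately show ?thesis by (simp only: a of_real_1 mult_1_left)
qed

text \<open>H composed with f is continuous on [0, L] and differentiable inside, so the interior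
  form of the fundamental theorem gives integrability of the singular integrand together with its
  value.\<close>

lemma has_integral_pullback:
  "((\<lambda>y. U (x_of y) * exp (\<i> * of_real (\<omega> * \<psi> (x_of y)))) has_integral
     of_real sg * \<epsilon> * (H S - H 0)) {0..L}"
proof -
  have "((\<lambda>y. U (x_of y) * exp (\<i> * of_real (\<omega> * \<psi> (x_of y)))) has_integral
     (of_real sg * \<epsilon> * H (f L) - of_real sg * \<epsilon> * H (f 0))) {0..L}"
  proof (rule fundamental_theorem_of_calculus_interior)
    show "continuous_on {0..L} (\<lambda>y. of_real sg * \<epsilon> * H (f y))"
      by (intro continuous_on_mult continuous_on_const continuous_on_compose2[OF H_cont f_cont])
         (simp add: f_image)
    fix y assume y: "y \<in> {0<..<L}"
    have at: "at y within {0..L} = at y"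
      using y by (intro at_within_interior) auto
    have "(f has_vector_derivative D y) (at y)"
      using f_deriv[of y] y by (simp add: at)
    moreover have "f y \<in> {0<..<S}"
      using f_less[of 0 y] f_less[of y L] f_0 y by (auto simp: S_eq)
    ultimately have "(H \<circ> f has_vector_derivative D y *\<^sub>R (ray.pw (\<mu> j - 1) (of_real (f y)) * k (f y))) (at y)"
      by (intro vector_diff_chain_at H_deriv)
    from has_vector_derivative_mult_right[OF this, of "of_real sg * \<epsilon>"]
    show "((\<lambda>y. of_real sg * \<epsilon> * H (f y)) has_vector_derivative
        U (x_of y) * exp (\<i> * of_real (\<omega> * \<psi> (x_of y)))) (at y)"
      by (simp only: integrand_pullback[OF y] comp_def)
  qed (use L in simp)
  then show ?thesis
    by (simp only: S_eq f_0 right_diff_distrib)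
qed

lemma has_integral_side:
  "((\<lambda>x. U x * exp (\<i> * of_real (\<omega> * \<psi> x))) has_integral
     of_real sg * \<epsilon> * (H S - H 0)) (I_sub p q j)"
proof -
  \<comment> \<open>Substitute y = sg (x - p_j). An integral over a set carries no orientation, so
    the Jacobian factor is 1 / |sg| = 1 and no sign appears for j = 2.\<close>
  have "((\<lambda>x. U (x_of (sg *\<^sub>R x + - sg * p j)) *
        exp (\<i> * of_real (\<omega> * \<psi> (x_of (sg *\<^sub>R x + - sg * p j))))) has_integral
     (1 / \<bar>sg\<bar> ^ DIM(real)) *\<^sub>R (of_real sg * \<epsilon> * (H S - H 0)))
     ((\<lambda>x. (1 / sg) *\<^sub>R x + - ((1 / sg) *\<^sub>R (- sg * p j))) ` cbox 0 L)"
    by (rule has_integral_affinity) (use has_integral_pullback sg_cases in auto)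
  moreover have "x_of (sg *\<^sub>R x + - sg * p j) = x" for x
    using sg_cases by auto
  moreover have "(\<lambda>x. (1 / sg) *\<^sub>R x + - ((1 / sg) *\<^sub>R (- sg * p j))) = x_of"
    using sg_cases by (auto simp: fun_eq_iff)
  moreover have "1 / \<bar>sg\<bar> ^ DIM(real) = 1"
    using sg_cases by auto
  ultimately show ?thesis by (simp only: scaleR_one I_sub_eq box_real)
qed

text \<open>Here \<open>L powr (\<rho> j - 1) * w L\<close> is \<psi>'(q), so apart from the sign
  the expression depends only on data at q.\<close>

definition boundary_term :: complex where
  "boundary_term = of_real sg * U q * exp (\<i> * of_real (\<omega> * \<psi> q)) /
     (\<i> * of_real (\<omega> * (L powr (\<rho> j - 1) * w L)))"

lemma q_x_of: "x_of L = q"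
  by (simp add: q)

lemma k_S: "k S = (sg * (S powr (1 - \<mu> j) / D L)) *\<^sub>R U q"
  using k_f[of L] L by (simp add: S_eq q_x_of)

text \<open>This is the boundary value at s = 0 of the integration by parts; \<Phi>(0) is a Gamma
  integral along the ray from the origin.\<close>

lemma A_term_eq: "A_term p \<rho> \<mu> \<psi> U q j \<omega> = - (of_real sg * \<epsilon> * (\<Phi> 0 * k 0))"
proof -
  have "Theta \<rho> \<mu> j = of_real (sg / \<rho> j * Gamma (\<mu> j / \<rho> j)) * cis (sg * (pi / 2 * (\<mu> j / \<rho> j)))"
    unfolding Theta_def ray.sg_complex by (simp add: side_sign_def cis_conv_exp mult_ac)
  then show ?thesis
    unfolding A_term_def Phi_eq ray.Lambda_integral_pw_0[OF mu(1)] by (simp add: mult_ac)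
qed

lemma R1_term_eq:
  "R1_term p \<rho> \<mu> \<psi> U q j \<omega> = - (of_real sg * \<epsilon> * integral {0..S} (\<lambda>s. \<Phi> s * k' s))"
  by (simp add: R1_term_def side_sign_def)

lemma R2_term_eq:
  "R2_term p \<rho> \<mu> \<psi> U q j \<omega> = - \<i> * of_real ((\<mu> j - \<rho> j) / \<rho> j) * \<epsilon> * k S *
     Lambda_integral \<rho> j S (ray.pw (\<mu> j - \<rho> j - 1)) / of_real \<omega>"
  using ray.omega
  by (simp add: R2_term_def ray.pw_def[abs_def] ray.osc_def powr_minus_divide)

text \<open>The powers of S collect to S^(1-\<rho>), so \<rho> S^(\<rho>-1) D(L) appears in the
  denominator, and by \<open>f_powr_D\<close> it equals \<psi>'(q).\<close>

lemma boundary_term_eq: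
  "boundary_term = \<epsilon> * k S * ray.pw (\<mu> j - \<rho> j) (of_real S) / (\<i> * of_real (\<omega> * \<rho> j))"
proof -
  define m where "m = L powr (\<rho> j - 1) * w L"
  have LL: "L \<in> {0..L}" "L \<in> {0<..L}" using L by auto
  have m: "\<rho> j * S powr (\<rho> j - 1) * D L = m"
    using f_powr_D[OF LL(2)] by (simp add: S_eq m_def)
  have nz: "S powr (\<rho> j - 1) > 0" "D L > 0" "\<rho> j > 0" using S_pos D_pos[OF LL(1)] rho by auto
  have "S powr (1 - \<mu> j) / D L * S powr (\<mu> j - \<rho> j) / \<rho> j = 1 / m"
  proof -
    have "S powr (1 - \<mu> j) * S powr (\<mu> j - \<rho> j) * S powr (\<rho> j - 1) = 1"
      using S_pos by (simp flip: powr_add)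
    then show ?thesis unfolding m[symmetric] using nz by (simp add: field_simps)
  qed
  then have c: "of_real (S powr (1 - \<mu> j) / D L * S powr (\<mu> j - \<rho> j) / \<rho> j) = (1 / of_real m :: complex)"
    by simp
  have hS: "S powr \<rho> j = h L" unfolding S_eq by (rule f_powr_rho[OF LL(1)])
  have phase_q: "\<psi> q = \<psi> (p j) + sg * h L" using phase_eq[of L] by (simp only: q_x_of)
  have e: "\<epsilon> * exp (\<i> * of_real (sg * \<omega> * S powr \<rho> j)) = exp (\<i> * of_real (\<omega> * \<psi> q))"
    unfolding hS phase_q exp_add[symmetric]
    by (simp add: algebra_simps)
  have "\<epsilon> * k S * ray.pw (\<mu> j - \<rho> j) (of_real S) / (\<i> * of_real (\<omega> * \<rho> j)) =
    of_real sg * U q * (\<epsilon> * exp (\<i> * of_real (sg * \<omega> * S powr \<rho> j))) *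
    of_real (S powr (1 - \<mu> j) / D L * S powr (\<mu> j - \<rho> j) / \<rho> j) / (\<i> * of_real \<omega>)"
    using S_pos by (simp add: k_S ray.pw_of_real scaleR_conv_of_real divide_inverse mult_ac)
  then show ?thesis
    unfolding c e boundary_term_def m_def[symmetric] by simp
qed

text \<open>Integration by parts along the ray with a = \<mu> - \<rho> trades the exponent \<mu> - 1
  for \<mu> - \<rho> - 1, which gives the second remainder, at the cost of a value at S, which is
  the boundary term.\<close>

lemma end_term_eq:
  "of_real sg * \<epsilon> * (\<Phi> S * k S) = R2_term p \<rho> \<mu> \<psi> U q j \<omega> + boundary_term"
proof -
  define \<Lambda>1 where "\<Lambda>1 = Lambda_integral \<rho> j S (ray.pw (\<mu> j - 1))"
  define \<Lambda>2 where "\<Lambda>2 = Lambda_integral \<rho> j S (ray.pw (\<mu> j - \<rho> j - 1))"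
  define P where "P = ray.pw (\<mu> j - \<rho> j) (of_real S)"
  have nz: "complex_of_real \<omega> \<noteq> 0" "complex_of_real (\<rho> j) \<noteq> 0" using ray.omega rho by auto
  have "of_real (\<mu> j - \<rho> j) * \<Lambda>2 + \<i> * of_real (sg * \<omega> * \<rho> j) * \<Lambda>1 = - P"
    using ray.Lambda_integral_pw_by_parts[of "\<mu> j - \<rho> j" S] mu S_pos
    by (simp add: \<Lambda>1_def \<Lambda>2_def P_def)
  then have *: "\<i> * of_real (sg * \<omega> * \<rho> j) * \<Lambda>1 = - P - of_real (\<mu> j - \<rho> j) * \<Lambda>2"
    by (simp only: eq_diff_eq add.commute)
  have "of_real sg * \<Lambda>1 = (- P - of_real (\<mu> j - \<rho> j) * \<Lambda>2) / (\<i> * of_real \<omega> * of_real (\<rho> j))"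
    unfolding *[symmetric] using nz by simp
  moreover have "of_real sg * \<epsilon> * (\<Phi> S * k S) = - (\<epsilon> * k S) * (of_real sg * \<Lambda>1)"
    by (simp add: Phi_eq \<Lambda>1_def[symmetric] mult_ac)
  ultimately have "of_real sg * \<epsilon> * (\<Phi> S * k S) =
      - (\<epsilon> * k S) * ((- P - of_real (\<mu> j - \<rho> j) * \<Lambda>2) / (\<i> * of_real \<omega> * of_real (\<rho> j)))"
    by (simp only:)
  also have "\<dots> = - \<i> * of_real ((\<mu> j - \<rho> j) / \<rho> j) * \<epsilon> * k S * \<Lambda>2 / of_real \<omega> +
      \<epsilon> * k S * P / (\<i> * of_real (\<omega> * \<rho> j))"
    using nz by (simp add: field_simps)
  finally show ?thesis
    unfolding R2_term_eq boundary_term_eq \<Lambda>2_def P_def .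
qed

lemma has_integral_expansion:
  "((\<lambda>x. U x * exp (\<i> * of_real (\<omega> * \<psi> x))) has_integral
     (A_term p \<rho> \<mu> \<psi> U q j \<omega> + R1_term p \<rho> \<mu> \<psi> U q j \<omega> + R2_term p \<rho> \<mu> \<psi> U q j \<omega>
      + boundary_term)) (I_sub p q j)"
proof -
  have "of_real sg * \<epsilon> * (H S - H 0) =
     A_term p \<rho> \<mu> \<psi> U q j \<omega> + R1_term p \<rho> \<mu> \<psi> U q j \<omega> + (R2_term p \<rho> \<mu> \<psi> U q j \<omega>
      + boundary_term)"
    unfolding A_term_eq R1_term_eq end_term_eq[symmetric] H_def
    by (simp add: algebra_simps)
  then show ?thesis
    using has_integral_side by (simp only: add.assoc)
qed

section \<open>Bounds for the two remainders\<close>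

lemma norm_exp_i [simp]: "norm \<epsilon> = 1"
  by simp

lemma norm_R1_term:
  "norm (R1_term p \<rho> \<mu> \<psi> U q j \<omega>) \<le>
     1 / \<rho> j * Gamma (1 / \<rho> j) * integral {0..S} (\<lambda>s. s powr (\<mu> j - 1) * norm (k' s)) *
     \<omega> powr (- (1 / \<rho> j))"
proof -
  obtain B where "\<forall>s\<in>{0..S}. norm (k' s) \<le> B"
    using compact_imp_bounded[OF compact_continuous_image[OF k_deriv_cont compact_Icc]]
    unfolding bounded_iff by auto
  then have B: "norm (k' s) \<le> B" if "s \<in> {0..S}" for s using that by blast
  \<comment> \<open>A bounded factor times the integrable power s^(\<mu>-1); s = 0 is left out so
    that the integrand is continuous, hence measurable.\<close>
  have "(\<lambda>s. s powr (\<mu> j - 1) * norm (k' s)) integrable_on {0<..S}"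
  proof (rule measurable_bounded_by_integrable_imp_integrable)
    have "continuous_on {0<..S} (\<lambda>s. s powr (\<mu> j - 1) * norm (k' s))"
      by (intro continuous_intros continuous_on_subset[OF k_deriv_cont]) auto
    then show "(\<lambda>s. s powr (\<mu> j - 1) * norm (k' s)) \<in> borel_measurable (lebesgue_on {0<..S})"
      by (rule continuous_imp_measurable_on_sets_lebesgue) auto
    show "(\<lambda>s. B * s powr (\<mu> j - 1)) integrable_on {0<..S}"
      using mu S_pos by (intro integrable_on_mult_right integrable_on_powr_from_0') auto
    show "norm (s powr (\<mu> j - 1) * norm (k' s)) \<le> B * s powr (\<mu> j - 1)" if "s \<in> {0<..S}" for s
      using mult_right_mono[OF B, of s "s powr (\<mu> j - 1)"] that by (simp add: mult_ac)
  qed auto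
  then have int: "(\<lambda>s. s powr (\<mu> j - 1) * norm (k' s)) integrable_on {0..S}"
    by (rule integrable_spike_set) (auto intro: negligible_subset[of "{0}"])
  \<comment> \<open>The value at s = 0 is replaced by 0 because
    \<open>0 powr (\<mu> j - 1) = 0\<close> makes the pointwise bound zero there; this does not
    change the integral.\<close>
  have "norm (integral {0..S} (\<lambda>s. if s = 0 then 0 else \<Phi> s * k' s)) \<le>
     integral {0..S} (\<lambda>s. ray.decay_const * (s powr (\<mu> j - 1) * norm (k' s)))"
  proof (rule integral_norm_bound_integral)
    show "(\<lambda>s. if s = 0 then 0 else \<Phi> s * k' s) integrable_on {0..S}"
      by (rule integrable_spike_finite[OF _ _ integrable_continuous_interval[OF Phi_k'_cont], of "{0}"]) auto
    show "(\<lambda>s. ray.decay_const * (s powr (\<mu> j - 1) * norm (k' s))) integrable_on {0..S}"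
      by (rule integrable_on_mult_right[OF int])
    fix s assume s: "s \<in> {0..S}"
    show "norm (if s = 0 then 0 else \<Phi> s * k' s) \<le> ray.decay_const * (s powr (\<mu> j - 1) * norm (k' s))"
      using mult_right_mono[OF norm_Phi norm_ge_zero, of s "k' s"] s
      by (auto simp: norm_mult mult_ac)
  qed
  moreover have "integral {0..S} (\<lambda>s. if s = 0 then 0 else \<Phi> s * k' s) = integral {0..S} (\<lambda>s. \<Phi> s * k' s)"
    by (rule integral_spike[of "{0}"]) auto
  moreover have "integral {0..S} (\<lambda>s. ray.decay_const * (s powr (\<mu> j - 1) * norm (k' s))) =
      ray.decay_const * integral {0..S} (\<lambda>s. s powr (\<mu> j - 1) * norm (k' s))"
    by (rule integral_mult_right)
  moreover have "norm (complex_of_real sg) = 1"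
    using sg_cases by auto
  ultimately show ?thesis
    by (simp only: R1_term_eq norm_mult norm_minus_cancel norm_exp_i mult_1_left ray.decay_const_def mult_ac)
qed

lemma norm_R2_term:
  "norm (R2_term p \<rho> \<mu> \<psi> U q j \<omega>) \<le>
     (\<rho> j - \<mu> j) / \<rho> j * Gamma (1 / \<rho> j) *
     norm (U q * of_real (inverse (vector_derivative (phi p \<rho> \<psi> j) (at q within I_sub p q j)))) *
     phi p \<rho> \<psi> j q powr (- \<rho> j) * \<omega> powr (- (1 + 1 / \<rho> j))"
proof -
  have DL: "D L > 0" using D_pos[of L] L by simp
  have sg1: "\<bar>sg\<bar> = 1" using sg_cases by auto
  have kS: "norm (k S) = S powr (1 - \<mu> j) * (norm (U q) / D L)"
    using DL by (simp add: k_S abs_mult sg1)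
  have \<Lambda>: "norm (Lambda_integral \<rho> j S (ray.pw (\<mu> j - \<rho> j - 1))) \<le>
      S powr (\<mu> j - \<rho> j - 1) * ray.decay_const"
    using mu rho S_pos by (intro ray.norm_Lambda_integral_pw) auto
  have G: "Gamma (1 / \<rho> j) > 0" using rho by (intro Gamma_real_pos) auto
  have "norm (R2_term p \<rho> \<mu> \<psi> U q j \<omega>) =
      (\<rho> j - \<mu> j) / \<rho> j * norm (k S) * norm (Lambda_integral \<rho> j S (ray.pw (\<mu> j - \<rho> j - 1))) / \<omega>"
    using ray.omega rho mu
    by (simp add: R2_term_eq norm_mult norm_divide flip: of_real_diff of_real_divide)
  also have "\<dots> \<le> (\<rho> j - \<mu> j) / \<rho> j * norm (k S) * (S powr (\<mu> j - \<rho> j - 1) * ray.decay_const) / \<omega>"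
    using ray.omega rho mu by (intro divide_right_mono mult_left_mono \<Lambda>) auto
  also have "\<dots> = 1 / \<rho> j * ((\<rho> j - \<mu> j) / \<rho> j * Gamma (1 / \<rho> j) * (norm (U q) / D L) *
      (S powr (1 - \<mu> j) * S powr (\<mu> j - \<rho> j - 1)) * (\<omega> powr (- (1 / \<rho> j)) * inverse \<omega>))"
    by (simp add: kS ray.decay_const_def divide_inverse mult_ac)
  also have "S powr (1 - \<mu> j) * S powr (\<mu> j - \<rho> j - 1) = S powr (- \<rho> j)"
    by (simp flip: powr_add)
  also have "\<omega> powr (- (1 / \<rho> j)) * inverse \<omega> = \<omega> powr (- (1 + 1 / \<rho> j))"
    using ray.omega by (simp add: powr_diff powr_minus divide_inverse)
  \<comment> \<open>The ray estimate carries a further factor 1/\<rho>, which is at most 1.\<close>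
  also have "1 / \<rho> j * ((\<rho> j - \<mu> j) / \<rho> j * Gamma (1 / \<rho> j) * (norm (U q) / D L) *
      S powr (- \<rho> j) * \<omega> powr (- (1 + 1 / \<rho> j))) \<le>
      1 * ((\<rho> j - \<mu> j) / \<rho> j * Gamma (1 / \<rho> j) * (norm (U q) / D L) *
      S powr (- \<rho> j) * \<omega> powr (- (1 + 1 / \<rho> j)))"
    using rho mu G DL by (intro mult_right_mono) auto
  also have "norm (U q) / D L =
      norm (U q * of_real (inverse (vector_derivative (phi p \<rho> \<psi> j) (at q within I_sub p q j))))"
    using DL by (simp only: phi_deriv_q norm_mult norm_of_real abs_inverse abs_mult sg1 mult_1_left
        divide_inverse abs_of_pos)
  finally show ?thesis
    by (simp only: s_end_def mult_1_left)
qed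

end

section \<open>Assembling the two endpoints\<close>

lemma phase_endpointI:
  fixes p \<rho> \<mu> :: "nat \<Rightarrow> real" and \<psi>t :: "real \<Rightarrow> real" and ut :: "real \<Rightarrow> complex"
  assumes j: "j \<in> {1, 2}" and q: "q \<in> {p 1<..<p 2}"
    and rho: "\<rho> 1 \<ge> 1" "\<rho> 2 \<ge> 1"
    and mu: "0 < \<mu> 1" "\<mu> 1 < 1" "0 < \<mu> 2" "\<mu> 2 < 1"
    and \<psi>t: "class_C 1 {p 1..p 2} \<psi>t" "\<And>x. x \<in> {p 1..p 2} \<Longrightarrow> \<psi>t x > 0"
    and \<psi>: "\<And>x. x \<in> {p 1..p 2} \<Longrightarrow> (\<psi> has_vector_derivative
            rpow (x - p 1) (\<rho> 1 - 1) * rpow (p 2 - x) (\<rho> 2 - 1) * \<psi>t x)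
            (at x within {p 1..p 2})"
    and ut: "class_C 1 {p 1..p 2} ut"
    and U: "\<And>x. x \<in> {p 1<..<p 2} \<Longrightarrow>
           U x = of_real ((x - p 1) powr (\<mu> 1 - 1) * (p 2 - x) powr (\<mu> 2 - 1)) * ut x"
  shows "phase_endpoint p \<rho> \<mu> \<psi> U q j \<bar>q - p j\<bar>
     (\<lambda>y. (p 2 - p 1 - y) powr (\<rho> (3 - j) - 1) * \<psi>t (p j + side_sign j * y))
     (\<lambda>y. (p 2 - p 1 - y) powr (\<mu> (3 - j) - 1) *\<^sub>R ut (p j + side_sign j * y))"
proof
  let ?sg = "side_sign j"
  let ?L = "\<bar>q - p j\<bar>"
  let ?x = "\<lambda>y. p j + ?sg * y"
  \<comment> \<open>The index 3 - j denotes the opposite endpoint, whose distance from x is p_2 -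
    p_1 - y. It stays positive up to q, which makes its powers smooth factors.\<close>
  have cases: "j = 1 \<and> ?sg = 1 \<and> 3 - j = 2 \<and> ?L = q - p 1 \<or> j = 2 \<and> ?sg = -1 \<and> 3 - j = 1 \<and> ?L = p 2 - q"
    using j q by (auto simp: side_sign_def)
  have sg2: "?sg * ?sg = 1" using cases by auto
  show "j \<in> {1, 2}" by (rule j)
  show "\<rho> j \<ge> 1" "0 < \<mu> j" "\<mu> j < 1" using j rho mu by auto
  show "0 < ?L" "q = p j + ?sg * ?L" using cases q by auto
  have img: "?x ` {0..?L} \<subseteq> {p 1..p 2}"
    using cases q by auto
  then have mem: "?x y \<in> {p 1..p 2}" if "y \<in> {0..?L}" for y
    using that by blast
  have pos: "p 2 - p 1 - y > 0" if "y \<in> {0..?L}" for y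
    using that cases q by auto
  have x_deriv: "(?x has_vector_derivative ?sg) (at y within A)" for y A
    by (auto intro!: derivative_eq_intros)
  have x_C1: "class_C 1 {0..?L} ?x"
    by (rule class_C_1I[OF x_deriv]) simp
  have "class_C 1 {0..?L} (\<lambda>y. p 2 - p 1 - y)"
    by (rule class_C_1I[of _ _ "\<lambda>_. -1"]) (auto intro!: derivative_eq_intros)
  then have pow_C1: "class_C 1 {0..?L} (\<lambda>y. (p 2 - p 1 - y) powr a)" for a
    by (rule class_C_1_powr) (rule pos)
  show "class_C 1 {0..?L} (\<lambda>y. (p 2 - p 1 - y) powr (\<rho> (3 - j) - 1) * \<psi>t (?x y))"
    by (intro class_C_1_mult pow_C1 class_C_1_compose[OF \<psi>t(1) x_C1 img])
  show "class_C 1 {0..?L} (\<lambda>y. (p 2 - p 1 - y) powr (\<mu> (3 - j) - 1) *\<^sub>R ut (?x y))"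
    by (intro class_C_1_scaleR pow_C1 class_C_1_compose[OF ut x_C1 img])
  fix y
  show "0 < (p 2 - p 1 - y) powr (\<rho> (3 - j) - 1) * \<psi>t (?x y)" if "y \<in> {0..?L}"
    using pos[OF that] \<psi>t(2)[OF mem[OF that]] by simp
  show "U (?x y) = y powr (\<mu> j - 1) *\<^sub>R ((p 2 - p 1 - y) powr (\<mu> (3 - j) - 1) *\<^sub>R ut (?x y))"
    if y: "y \<in> {0<..?L}"
  proof -
    have "?x y \<in> {p 1<..<p 2}" using y cases q by auto
    then show ?thesis
      using cases by (elim disjE conjE) (simp_all add: U scaleR_conv_of_real mult_ac algebra_simps)
  qed
  show "((\<lambda>y. ?sg * (\<psi> (?x y) - \<psi> (p j))) has_vector_derivative
      rpow y (\<rho> j - 1) * ((p 2 - p 1 - y) powr (\<rho> (3 - j) - 1) * \<psi>t (?x y))) (at y within {0..?L})"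
    if y: "y \<in> {0..?L}"
  proof -
    define m where "m = rpow (?x y - p 1) (\<rho> 1 - 1) * rpow (p 2 - ?x y) (\<rho> 2 - 1) * \<psi>t (?x y)"
    have "(\<psi> \<circ> ?x has_vector_derivative ?sg *\<^sub>R m) (at y within {0..?L})"
      unfolding m_def
      by (rule vector_diff_chain_within[OF x_deriv has_vector_derivative_within_subset[OF \<psi>[OF mem[OF y]] img]])
    then have "((\<lambda>y. ?sg * (\<psi> (?x y) - \<psi> (p j))) has_vector_derivative ?sg * (?sg * m - 0)) (at y within {0..?L})"
      by (intro has_vector_derivative_mult_right has_vector_derivative_diff has_vector_derivative_const)
         (simp add: comp_def)
    moreover have "?sg * (?sg * m - 0) = m" using cases by auto
    moreover have "m = rpow y (\<rho> j - 1) * ((p 2 - p 1 - y) powr (\<rho> (3 - j) - 1) * \<psi>t (?x y))"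
    proof -
      \<comment> \<open>At the opposite endpoint's factor the base is positive, so
        \<open>rpow\<close> and \<open>powr\<close> agree even for exponent 0.\<close>
      have "rpow (p 2 - (p 1 + y)) a = (p 2 - p 1 - y) powr a"
        "rpow (p 2 - y - p 1) a = (p 2 - p 1 - y) powr a" for a
        using pos[OF y] by (simp_all add: rpow_def algebra_simps)
      then show ?thesis
        unfolding m_def using cases by (elim disjE conjE) (simp_all add: mult_ac)
    qed
    ultimately show ?thesis by (simp only:)
  qed
qed

text \<open>The boundary term is rewritten with a constant B that does not involve j, so that only
  \<open>side_sign j\<close> distinguishes the two sides of q.\<close>

lemma endpoint_contribution:
  fixes p \<rho> \<mu> :: "nat \<Rightarrow> real" and \<psi> \<psi>t :: "real \<Rightarrow> real" and U v :: "real \<Rightarrow> complex"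
    and q \<omega> :: real
  defines "B \<equiv> U q * exp (\<i> * of_real (\<omega> * \<psi> q)) /
       (\<i> * of_real (\<omega> * ((q - p 1) powr (\<rho> 1 - 1) * (p 2 - q) powr (\<rho> 2 - 1) * \<psi>t q)))"
  assumes endpoint: "phase_endpoint p \<rho> \<mu> \<psi> U q j \<bar>q - p j\<bar>
     (\<lambda>y. (p 2 - p 1 - y) powr (\<rho> (3 - j) - 1) * \<psi>t (p j + side_sign j * y)) v"
    and q: "q \<in> {p 1<..<p 2}" and \<omega>: "\<omega> > 0"
  shows "((\<lambda>x. U x * exp (\<i> * of_real (\<omega> * \<psi> x))) has_integral
       (A_term p \<rho> \<mu> \<psi> U q j \<omega> + R1_term p \<rho> \<mu> \<psi> U q j \<omega> + R2_term p \<rho> \<mu> \<psi> U q j \<omega>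
        + of_real (side_sign j) * B)) (I_sub p q j)" (is ?integral)
    and "norm (R1_term p \<rho> \<mu> \<psi> U q j \<omega>) \<le>
         1 / \<rho> j * Gamma (1 / \<rho> j) *
         integral {0..s_end p \<rho> \<psi> q j}
           (\<lambda>s. s powr (\<mu> j - 1) * norm (k_deriv p \<rho> \<mu> \<psi> U q j s)) *
         \<omega> powr (- (1 / \<rho> j))" (is ?R1)
    and "norm (R2_term p \<rho> \<mu> \<psi> U q j \<omega>) \<le>
         (\<rho> j - \<mu> j) / \<rho> j * Gamma (1 / \<rho> j) *
         norm (U q * of_real (inverse
           (vector_derivative (phi p \<rho> \<psi> j) (at q within I_sub p q j)))) *
         phi p \<rho> \<psi> j q powr (- \<rho> j) *
         \<omega> powr (- (1 + 1 / \<rho> j))" (is ?R2)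
proof -
  let ?w = "\<lambda>y. (p 2 - p 1 - y) powr (\<rho> (3 - j) - 1) * \<psi>t (p j + side_sign j * y)"
  interpret e: phase_endpoint p \<rho> \<mu> \<psi> U q j "\<bar>q - p j\<bar>" ?w v
    by (rule endpoint)
  obtain W where "phase_factor p \<rho> \<mu> \<psi> U q j \<bar>q - p j\<bar> ?w v W"
    by (rule e.phase_factor_exists)
  then interpret f: phase_factor p \<rho> \<mu> \<psi> U q j "\<bar>q - p j\<bar>" ?w v W .
  interpret r: endpoint_expansion p \<rho> \<mu> \<psi> U q j "\<bar>q - p j\<bar>" ?w v W \<omega>
    by unfold_locales (use e.rho \<omega> in auto)
  have "\<bar>q - p j\<bar> powr (\<rho> j - 1) * ?w \<bar>q - p j\<bar> =
      (q - p 1) powr (\<rho> 1 - 1) * (p 2 - q) powr (\<rho> 2 - 1) * \<psi>t q"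
    using e.j q by (auto simp: side_sign_def)
  then have "r.boundary_term = of_real (side_sign j) * B"
    unfolding r.boundary_term_def B_def by simp
  then show ?integral using r.has_integral_expansion by simp
  show ?R1 by (rule r.norm_R1_term)
  show ?R2 by (rule r.norm_R2_term)
qed

theorem theorem1p2:
  fixes p \<rho> \<mu> :: "nat \<Rightarrow> real" and N :: nat and \<psi> :: "real \<Rightarrow> real"
    and U :: "real \<Rightarrow> complex" and q :: real
  assumes "p 1 < p 2" and "N \<noteq> 0"
    and "\<rho> 1 \<ge> 1" and "\<rho> 2 \<ge> 1"
    and "0 < \<mu> 1" and "\<mu> 1 < 1" and "0 < \<mu> 2" and "\<mu> 2 < 1"
    and "assumption_P p \<rho> N \<psi>"
    and "assumption_A p \<mu> N U"
    and "q \<in> {p 1<..<p 2}"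
  shows "\<forall>\<omega>>0.
    ((\<lambda>x. U x * exp (\<i> * of_real (\<omega> * \<psi> x))) has_integral
       (\<Sum>j\<in>{1, 2}. A_term p \<rho> \<mu> \<psi> U q j \<omega> + R1_term p \<rho> \<mu> \<psi> U q j \<omega>
          + R2_term p \<rho> \<mu> \<psi> U q j \<omega>)) {p 1<..<p 2} \<and>
    (\<forall>j\<in>{1, 2}.
       norm (R1_term p \<rho> \<mu> \<psi> U q j \<omega>) \<le>
         1 / \<rho> j * Gamma (1 / \<rho> j) *
         integral {0..s_end p \<rho> \<psi> q j}
           (\<lambda>s. s powr (\<mu> j - 1) * norm (k_deriv p \<rho> \<mu> \<psi> U q j s)) *
         \<omega> powr (- (1 / \<rho> j)) \<and>
       norm (R2_term p \<rho> \<mu> \<psi> U q j \<omega>) \<le>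
         (\<rho> j - \<mu> j) / \<rho> j * Gamma (1 / \<rho> j) *
         norm (U q * of_real (inverse
           (vector_derivative (phi p \<rho> \<psi> j) (at q within I_sub p q j)))) *
         phi p \<rho> \<psi> j q powr (- \<rho> j) *
         \<omega> powr (- (1 + 1 / \<rho> j)))"
proof (intro allI impI)
  fix \<omega> :: real assume \<omega>: "\<omega> > 0"
  obtain M where N: "N = Suc M" using assms(2) not0_implies_Suc by blast
  obtain \<psi>t where \<psi>t: "class_C N {p 1..p 2} \<psi>t" "\<And>x. x \<in> {p 1..p 2} \<Longrightarrow> \<psi>t x > 0"
    and \<psi>: "\<And>x. x \<in> {p 1..p 2} \<Longrightarrow> (\<psi> has_vector_derivative
            rpow (x - p 1) (\<rho> 1 - 1) * rpow (p 2 - x) (\<rho> 2 - 1) * \<psi>t x)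
            (at x within {p 1..p 2})"
    using assms(9) unfolding assumption_P_def by (elim conjE exE) blast
  obtain ut where ut: "class_C N {p 1..p 2} ut" and U: "\<And>x. x \<in> {p 1<..<p 2} \<Longrightarrow>
           U x = of_real ((x - p 1) powr (\<mu> 1 - 1) * (p 2 - x) powr (\<mu> 2 - 1)) * ut x"
    using assms(10) unfolding assumption_A_def by (elim conjE exE) blast
  note C1 = \<psi>t(1)[unfolded N, THEN class_C_1_of_Suc] ut[unfolded N, THEN class_C_1_of_Suc]
  note endpoint = phase_endpointI[OF _ assms(11,3-8) C1(1) \<psi>t(2) \<psi> C1(2) U]
  note contribution = endpoint_contribution[OF endpoint assms(11) \<omega>]
  define B where "B = U q * exp (\<i> * of_real (\<omega> * \<psi> q)) /
       (\<i> * of_real (\<omega> * ((q - p 1) powr (\<rho> 1 - 1) * (p 2 - q) powr (\<rho> 2 - 1) * \<psi>t q)))"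
  define T where "T j = A_term p \<rho> \<mu> \<psi> U q j \<omega> + R1_term p \<rho> \<mu> \<psi> U q j \<omega>
      + R2_term p \<rho> \<mu> \<psi> U q j \<omega>" for j
  let ?f = "\<lambda>x. U x * exp (\<i> * of_real (\<omega> * \<psi> x))"
  have "(?f has_integral T 1 + B) {p 1..q}" "(?f has_integral T 2 - B) {q..p 2}"
    using contribution(1)[of 1] contribution(1)[of 2]
    by (simp_all add: T_def B_def I_sub_def side_sign_def)
  \<comment> \<open>The terms B and -B cancel when the two pieces are joined at q. Passing to the
    open interval, on which U is prescribed, discards only a null set.\<close>
  from has_integral_combine[OF _ _ this] assms(11)
  have "(?f has_integral (\<Sum>j\<in>{1, 2}. T j)) {p 1<..<p 2}"
    by (simp add: has_integral_Icc_iff_Ioo)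
  then show "(?f has_integral (\<Sum>j\<in>{1, 2}. A_term p \<rho> \<mu> \<psi> U q j \<omega> + R1_term p \<rho> \<mu> \<psi> U q j \<omega>
          + R2_term p \<rho> \<mu> \<psi> U q j \<omega>)) {p 1<..<p 2} \<and>
    (\<forall>j\<in>{1, 2}.
       norm (R1_term p \<rho> \<mu> \<psi> U q j \<omega>) \<le>
         1 / \<rho> j * Gamma (1 / \<rho> j) *
         integral {0..s_end p \<rho> \<psi> q j}
           (\<lambda>s. s powr (\<mu> j - 1) * norm (k_deriv p \<rho> \<mu> \<psi> U q j s)) *
         \<omega> powr (- (1 / \<rho> j)) \<and>
       norm (R2_term p \<rho> \<mu> \<psi> U q j \<omega>) \<le>
         (\<rho> j - \<mu> j) / \<rho> j * Gamma (1 / \<rho> j) *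
         norm (U q * of_real (inverse
           (vector_derivative (phi p \<rho> \<psi> j) (at q within I_sub p q j)))) *
         phi p \<rho> \<psi> j q powr (- \<rho> j) *
         \<omega> powr (- (1 + 1 / \<rho> j)))"
    unfolding T_def using contribution(2,3) by blast
qed

end
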